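(* Let $G$ be a finite simple graph that is claw-free (i.e., $G$ has no induced subgraph isomorphic to $K_{1,3}$) and has maximum degree $\Delta(G)\le 4$. Then $\chi_i'(G)\le 13$, i.e., $G$ admits an injective $13$-edge-coloring.
   Context: An injective $k$-edge-coloring of a graph $G$ is a map $\phi: E(G)\to\{1,2,\dots,k\}$ such that $\phi(e)\neq\phi(e')$ whenever the distinct edges $e,e'$ are at distance two (they share no endpoint and some edge of $G$ joins an endpoint of $e$ to an endpoint of $e'$, so that $e$, this joining edge, and $e'$ form a path of three edges) or $e$ and $e'$ lie in a common triangle of $G$. Edges that merely share an endpoint without lying in a common triangle may receive the same color. The injective chromatic index $\chi_i'(G)$ is the smallest $k$ such that $G$ has an injective $k$-edge-coloring. *)

theory Defs
  imports Main
begin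

locale finite_simple_graph =
  fixes V :: "'a set" and E :: "'a set set"
  assumes finite_vertices: "finite V"
    and edge_subset: "e \<in> E \<Longrightarrow> e \<subseteq> V"
    and edge_card: "e \<in> E \<Longrightarrow> card e = 2"

definition degree :: "'a set set \<Rightarrow> 'a \<Rightarrow> nat" where
  "degree E v = card {e \<in> E. v \<in> e}"

text \<open>Inserting \<open>0\<close> only matters for the graph without vertices, whose maximum degree is \<open>0\<close>.\<close>

definition max_degree :: "'a set \<Rightarrow> 'a set set \<Rightarrow> nat" where
  "max_degree V E = Max (insert 0 (degree E ` V))"

definition induced_edges :: "'a set set \<Rightarrow> 'a set \<Rightarrow> 'a set set" where
  "induced_edges E S = {e \<in> E. e \<subseteq> S}"

definition graph_isomorphic ::
    "'a set \<Rightarrow> 'a set set \<Rightarrow> 'b set \<Rightarrow> 'b set set \<Rightarrow> bool" where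
  "graph_isomorphic V E V' E' \<longleftrightarrow>
     (\<exists>f. bij_betw f V V' \<and> (\<forall>u\<in>V. \<forall>v\<in>V. {u, v} \<in> E \<longleftrightarrow> {f u, f v} \<in> E'))"

definition claw_vertices :: "nat set" where
  "claw_vertices = {0, 1, 2, 3}"

definition claw_edges :: "nat set set" where
  "claw_edges = {{0, 1}, {0, 2}, {0, 3}}"

definition claw_free :: "'a set \<Rightarrow> 'a set set \<Rightarrow> bool" where
  "claw_free V E \<longleftrightarrow>
     \<not> (\<exists>S \<subseteq> V. graph_isomorphic S (induced_edges E S) claw_vertices claw_edges)"

definition at_distance_two :: "'a set set \<Rightarrow> 'a set \<Rightarrow> 'a set \<Rightarrow> bool" where
  "at_distance_two E e e' \<longleftrightarrow> e \<inter> e' = {} \<and> (\<exists>u\<in>e. \<exists>v\<in>e'. {u, v} \<in> E)"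

definition in_common_triangle :: "'a set set \<Rightarrow> 'a set \<Rightarrow> 'a set \<Rightarrow> bool" where
  "in_common_triangle E e e' \<longleftrightarrow>
     (\<exists>a b c. a \<noteq> b \<and> b \<noteq> c \<and> a \<noteq> c \<and> {a, b} \<in> E \<and> {b, c} \<in> E \<and> {a, c} \<in> E \<and>
        e \<in> {{a, b}, {b, c}, {a, c}} \<and> e' \<in> {{a, b}, {b, c}, {a, c}})"

definition injective_edge_coloring :: "'a set set \<Rightarrow> nat \<Rightarrow> ('a set \<Rightarrow> nat) \<Rightarrow> bool" where
  "injective_edge_coloring E k \<phi> \<longleftrightarrow>
     (\<forall>e\<in>E. \<phi> e \<in> {1..k}) \<and>
     (\<forall>e\<in>E. \<forall>e'\<in>E. e \<noteq> e' \<longrightarrow>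
        at_distance_two E e e' \<or> in_common_triangle E e e' \<longrightarrow> \<phi> e \<noteq> \<phi> e')"

definition injective_chromatic_index :: "'a set set \<Rightarrow> nat" where
  "injective_chromatic_index E = (LEAST k. \<exists>\<phi>. injective_edge_coloring E k \<phi>)"

text \<open>The \<open>LEAST\<close> above is underspecified unless some coloring exists.\<close>

lemma (in finite_simple_graph) injective_edge_coloring_exists:
  "\<exists>k \<phi>. injective_edge_coloring E k \<phi>"
proof -
  have "E \<subseteq> Pow V"
    using edge_subset by blast
  then have "finite E"
    by (rule finite_subset) (simp add: finite_vertices)
  then obtain h where h: "bij_betw h E {0..<card E}"
    using ex_bij_betw_finite_nat by blast
  have "h e \<noteq> h e'" if "e \<in> E" "e' \<in> E" "e \<noteq> e'" for e e'
    using inj_onD[OF bij_betw_imp_inj_on[OF h]] that by blast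
  moreover have "Suc (h e) \<in> {1..card E}" if "e \<in> E" for e
  proof -
    have "h e \<in> {0..<card E}"
      using bij_betwE[OF h] that by blast
    then show ?thesis by simp
  qed
  ultimately have "injective_edge_coloring E (card E) (\<lambda>e. Suc (h e))"
    unfolding injective_edge_coloring_def by (simp only: nat.inject) blast
  then show ?thesis by blast
qed

lemma (in finite_simple_graph) injective_edge_coloring_index:
  "\<exists>\<phi>. injective_edge_coloring E (injective_chromatic_index E) \<phi>"
  unfolding injective_chromatic_index_def
  using injective_edge_coloring_exists by (rule LeastI_ex)

end

theory Submission
  imports Defs
begin

text \<open>Colour the conflict graph, whose vertices are the edges of G. In a minimal set W of edges
  that is not 13-colourable every edge has at least 13 conflicts inside W. Double counting bounds
  the number of conflicts of an edge, and shows that an edge of W lies in a unique triangle, that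
  it has at most 14 conflicts, and that around it the graph is locally the line graph of a
  triangle-free cubic graph. Remove from W the twelve edges of a triangle and of the three
  triangles meeting it, and colour the rest; each of the twelve edges keeps a list of colours that
  is at most one shorter than its number of conflicts among the twelve. This list colouring problem
  is solvable: greedy colouring works once a few pairs of non-conflicting edges are coloured so that
  a common conflicting edge loses only one colour.\<close>

section \<open>List colouring with slack\<close>

text \<open>The price is that edges near \<open>W\<close> may lie outside it. The count makes up for
  this: an edge of \<open>W\<close> has at most 14 conflicts and at least 13 of them in
  \<open>W\<close>, so of any two of its conflicts one is in \<open>W\<close>, and membership
  spreads from triangle to triangle.

  The gap between 14 conflicts and 13 colours is also why each list may be one shorter than the
  degree, two short of what greedy colouring wants. Two situations remain. If no edge joins two of
  the outer triangles, the conflicts among the twelve edges are completely known. If some edge does,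
  not all of them are known, but three of the twelve edges have only 13 conflicts, and this extra
  slack compensates.\<close>

definition list_colorable :: "('v \<Rightarrow> 'v \<Rightarrow> bool) \<Rightarrow> 'v set \<Rightarrow> ('v \<Rightarrow> 'c set) \<Rightarrow> bool" where
  "list_colorable A R L \<longleftrightarrow>
     (\<exists>\<phi>. (\<forall>v\<in>R. \<phi> v \<in> L v) \<and> (\<forall>u\<in>R. \<forall>v\<in>R. A u v \<longrightarrow> \<phi> u \<noteq> \<phi> v))"

definition degree_in :: "('v \<Rightarrow> 'v \<Rightarrow> bool) \<Rightarrow> 'v set \<Rightarrow> 'v \<Rightarrow> nat" where
  "degree_in A R v = card {u \<in> R. A v u}"

text \<open>Slack \<open>s\<close> means a list of at least degree plus \<open>s\<close> minus one
  colours; the shift keeps slacks natural. Slack 0 is what 14 conflicts and 13 colours leave, slack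
  1 what 13 conflicts leave, and with slack 2 a vertex can be coloured last. The degree is the true
  one in \<open>A\<close>, so slacks can be tracked when \<open>A\<close> is only partly
  known.\<close>

definition slack_colorable :: "('v \<Rightarrow> 'v \<Rightarrow> bool) \<Rightarrow> 'v set \<Rightarrow> ('v \<Rightarrow> nat) \<Rightarrow> bool" where
  "slack_colorable A R s \<longleftrightarrow>
     (\<forall>L :: 'v \<Rightarrow> nat set. (\<forall>v\<in>R. finite (L v) \<and> degree_in A R v + s v \<le> card (L v) + 1) \<longrightarrow>
        list_colorable A R L)"

lemma list_colorable_mono:
  assumes "list_colorable A R L" "\<And>v. v \<in> R \<Longrightarrow> L v \<subseteq> L' v"
  shows "list_colorable A R L'"
  using assms unfolding list_colorable_def by blast

lemma list_colorable_insert: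
  assumes A: "symp A" "irreflp A" and x: "t \<in> L x"
    and col: "list_colorable A (R - {x}) (\<lambda>u. if A u x then L u - {t} else L u)"
  shows "list_colorable A R L"
proof -
  obtain \<phi> where \<phi>: "\<forall>v\<in>R - {x}. \<phi> v \<in> (if A v x then L v - {t} else L v)"
      "\<forall>u\<in>R - {x}. \<forall>v\<in>R - {x}. A u v \<longrightarrow> \<phi> u \<noteq> \<phi> v"
    using col unfolding list_colorable_def by blast
  have "\<forall>v\<in>R. (\<phi>(x := t)) v \<in> L v"
    using \<phi>(1) x by (auto split: if_splits)
  moreover have "(\<phi>(x := t)) u \<noteq> (\<phi>(x := t)) v" if "u \<in> R" "v \<in> R" "A u v" for u v
  proof (cases "u = x \<or> v = x")
    case True
    have "\<not> A x x" using A(2) by (simp add: irreflp_def)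
    with True that consider "u = x" "v \<noteq> x" "A v x" | "u \<noteq> x" "v = x"
      using A(1) by (metis sympD)
    then show ?thesis using \<phi>(1) that by cases (auto split: if_splits)
  next
    case False
    then show ?thesis using \<phi>(2) that by simp
  qed
  ultimately show ?thesis unfolding list_colorable_def by blast
qed

lemma degree_in_remove:
  assumes "finite R" "x \<in> R"
  shows "degree_in A R v = degree_in A (R - {x}) v + (if A v x then 1 else 0)"
proof -
  have *: "{u \<in> R. A v u} = (if A v x then insert x {u \<in> R - {x}. A v u} else {u \<in> R - {x}. A v u})"
    using assms by auto
  show ?thesis
    unfolding degree_in_def by (subst *) (use assms in simp)
qed

text \<open>The vertex \<open>v\<close> is coloured last: its list exceeds its degree, so a colour
  survives whatever its neighbours receive. Postponing it lowers their degrees but not their lists,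
  which raises their slack.\<close>

lemma slack_colorable_peel:
  assumes A: "symp A" "irreflp A" and R: "finite R" "v \<in> R" and sv: "2 \<le> s v"
    and ok: "slack_colorable A (R - {v}) s'"
    and s': "\<And>u. u \<in> R - {v} \<Longrightarrow> s' u \<le> s u + (if A u v then 1 else 0)"
  shows "slack_colorable A R s"
  unfolding slack_colorable_def
proof (intro allI impI)
  fix L :: "'a \<Rightarrow> nat set"
  assume L: "\<forall>v\<in>R. finite (L v) \<and> degree_in A R v + s v \<le> card (L v) + 1"
  have "list_colorable A (R - {v}) L"
  proof (rule ok[unfolded slack_colorable_def, rule_format])
    fix u assume u: "u \<in> R - {v}"
    have "degree_in A R u + s u \<le> card (L u) + 1" "finite (L u)" using L u by auto
    then show "finite (L u) \<and> degree_in A (R - {v}) u + s' u \<le> card (L u) + 1"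
      using degree_in_remove[OF R, of A u] s'[OF u] by (auto split: if_splits)
  qed
  then obtain \<phi> where \<phi>: "\<forall>u\<in>R - {v}. \<phi> u \<in> L u"
      "\<forall>u\<in>R - {v}. \<forall>w\<in>R - {v}. A u w \<longrightarrow> \<phi> u \<noteq> \<phi> w"
    unfolding list_colorable_def by blast
  have "card (\<phi> ` {u \<in> R. A v u}) \<le> degree_in A R v"
    unfolding degree_in_def using R by (intro card_image_le) simp
  also have "\<dots> < card (L v)" using L R(2) sv by force
  finally have "\<not> L v \<subseteq> \<phi> ` {u \<in> R. A v u}"
    using R(1) card_mono
    by (metis (no_types, lifting) finite_imageI finite_Collect_conjI linorder_not_less mem_Collect_eq
        finite_subset subsetI)
  then obtain t where t: "t \<in> L v" "t \<notin> \<phi> ` {u \<in> R. A v u}" by blast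
  show "list_colorable A R L"
  proof (rule list_colorable_insert[where L = L, OF A t(1)])
    have "\<phi> u \<noteq> t" if "u \<in> R" "A u v" for u
      using t(2) that A(1) by (auto dest: sympD)
    then show "list_colorable A (R - {v}) (\<lambda>u. if A u v then L u - {t} else L u)"
      unfolding list_colorable_def using \<phi> by (intro exI[of _ \<phi>]) auto
  qed
qed

text \<open>Two non-adjacent neighbours of z either share a colour, or one of them has a colour missing
  from the list of z, because their disjoint lists are together longer than that of z.\<close>

lemma slack_colorable_pair:
  assumes A: "symp A" "irreflp A" and R: "finite R" "x \<in> R" "y \<in> R" "z \<in> R"
    and xyz: "x \<noteq> y" "\<not> A x y" "A z x" "A z y"
    and size: "degree_in A R z + s z + 1 < degree_in A R x + s x + (degree_in A R y + s y)"
    and ok: "slack_colorable A (R - {x} - {y}) s1" "slack_colorable A (R - {x}) s2"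
            "slack_colorable A (R - {y}) s2"
    and s1: "\<And>u. u \<in> R \<Longrightarrow> s1 u \<le> s u + (if A u x \<and> A u y then 1 else 0)"
    and s2: "\<And>u. u \<in> R \<Longrightarrow> s2 u \<le> s u + (if u = z then 1 else 0)"
  shows "slack_colorable A R s"
  unfolding slack_colorable_def
proof (intro allI impI)
  fix L :: "'a \<Rightarrow> nat set"
  assume L: "\<forall>v\<in>R. finite (L v) \<and> degree_in A R v + s v \<le> card (L v) + 1"
  \<comment> \<open>Lists are bounded only from below. Cutting the list of \<open>z\<close> to
    exactly degree plus slack minus one colours makes the comparison of sizes decisive; the positive
    degree keeps the subtraction from truncating.\<close>
  have "0 < degree_in A R z"
    unfolding degree_in_def using R xyz by (auto simp: card_gt_0_iff)
  moreover have "degree_in A R z + s z - 1 \<le> card (L z)" using L R by force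
  ultimately obtain Z where Z: "Z \<subseteq> L z" "card Z + 1 = degree_in A R z + s z" "finite Z"
    using obtain_subset_with_card_n
    by (metis (no_types, lifting) add_gr_0 le_add_diff_inverse2 less_one linorder_not_less
        less_eq_Suc_le One_nat_def L R(4) finite_subset)
  define L' where "L' = L(z := Z)"
  have L': "finite (L' v)" "degree_in A R v + s v \<le> card (L' v) + 1" if "v \<in> R" for v
    using L that Z by (auto simp: L'_def)
  have xz: "x \<noteq> z" "y \<noteq> z" using A(2) xyz by (auto simp: irreflp_def)
  \<comment> \<open>With \<open>t\<close> outside the list of \<open>z\<close>, colouring
    \<open>w\<close> costs \<open>z\<close> a neighbour but no colour, so \<open>z\<close> gains
    slack. Any other neighbour of \<open>w\<close> loses one neighbour and at most one
    colour.\<close>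
  have single: "list_colorable A R L'"
    if w: "w \<in> R" "A z w" "slack_colorable A (R - {w}) s2" and t: "t \<in> L' w" "t \<notin> Z" for w t
  proof (rule list_colorable_insert[where L = L', OF A t(1)])
    show "list_colorable A (R - {w}) (\<lambda>u. if A u w then L' u - {t} else L' u)"
    proof (rule w(3)[unfolded slack_colorable_def, rule_format])
      fix u assume u: "u \<in> R - {w}"
      have "u = z \<Longrightarrow> L' u - {t} = L' u" using t(2) by (simp add: L'_def)
      moreover have "card (L' u) \<le> card (L' u - {t}) + 1"
        using L'(1)[of u] u by (auto simp: card_Diff_singleton_if)
      ultimately show "finite (if A u w then L' u - {t} else L' u) \<and>
          degree_in A (R - {w}) u + s2 u \<le> card (if A u w then L' u - {t} else L' u) + 1"
        using L'[of u] u s2[of u] degree_in_remove[OF R(1) w(1), of A u] w(2)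
        by (auto split: if_splits)
    qed
  qed
  have "list_colorable A R L'"
  proof (cases "L' x \<inter> L' y = {}")
    case True
    have "card Z < card (L' x) + card (L' y)"
      using L'(2)[OF R(2)] L'(2)[OF R(3)] size Z(2) by linarith
    also have "\<dots> = card (L' x \<union> L' y)"
      using True L'(1) R by (simp add: card_Un_disjoint)
    finally have "\<not> L' x \<union> L' y \<subseteq> Z"
      using Z(3) card_mono linorder_not_less by blast
    then obtain t where "t \<in> L' x \<or> t \<in> L' y" "t \<notin> Z" by blast
    then show ?thesis using single[of x t] single[of y t] R xyz ok by blast
  next
    case False
    then obtain t where t: "t \<in> L' x" "t \<in> L' y" by blast
    \<comment> \<open>Giving \<open>t\<close> to both \<open>x\<close> and \<open>y\<close> takes
      two uncoloured neighbours but only one colour from each common neighbour.\<close>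
    define M where "M = (\<lambda>u. if A u x then L' u - {t} else L' u)"
    show ?thesis
    proof (rule list_colorable_insert[where L = L', OF A t(1)], fold M_def, rule list_colorable_insert[OF A])
      show "t \<in> M y" using t(2) xyz(2) A(1) by (auto simp: M_def dest: sympD)
      show "list_colorable A (R - {x} - {y}) (\<lambda>u. if A u y then M u - {t} else M u)"
      proof (rule ok(1)[unfolded slack_colorable_def, rule_format])
        fix u assume u: "u \<in> R - {x} - {y}"
        have "card (L' u) \<le> card (L' u - {t}) + 1"
          using L'(1)[of u] u by (auto simp: card_Diff_singleton_if)
        moreover have "degree_in A R u = degree_in A (R - {x} - {y}) u
            + (if A u x then 1 else 0) + (if A u y then 1 else 0)"
          using degree_in_remove[OF R(1,2), of A u] degree_in_remove[of "R - {x}" y A u] R xyz by simp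
        moreover have "finite (if A u y then M u - {t} else M u)"
          using L'(1)[of u] u by (simp add: M_def)
        ultimately show "finite (if A u y then M u - {t} else M u) \<and>
            degree_in A (R - {x} - {y}) u + s1 u \<le> card (if A u y then M u - {t} else M u) + 1"
          using L'(2)[of u] u s1[of u] by (auto simp: M_def split: if_splits)
      qed
    qed
  qed
  then show "list_colorable A R L"
    by (rule list_colorable_mono) (use Z(1) in \<open>auto simp: L'_def\<close>)
qed

section \<open>A checker for colouring strategies\<close>

text \<open>The sub-strategies of \<open>Pair x y z\<close> serve its outcomes in turn:
  \<open>x\<close> and \<open>y\<close> share a colour, \<open>x\<close> takes a colour missing at
  \<open>z\<close>, \<open>y\<close> takes one.\<close>

datatype strategy = Greedy | Pair nat nat nat strategy strategy strategy

definition bump :: "(nat \<Rightarrow> bool) \<Rightarrow> nat list \<Rightarrow> nat list" where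
  "bump p s = map (\<lambda>u. if p u then Suc (s ! u) else s ! u) [0..<length s]"

text \<open>The first peelable vertex can be taken without backtracking, because peeling never
  lowers a slack. The number is fuel, one unit for each vertex.\<close>

fun peels :: "(nat \<Rightarrow> nat \<Rightarrow> bool) \<Rightarrow> nat \<Rightarrow> nat list \<Rightarrow> nat list \<Rightarrow> bool" where
  "peels k 0 R s \<longleftrightarrow> R = []"
| "peels k (Suc n) R s \<longleftrightarrow>
     (case find (\<lambda>v. 2 \<le> s ! v) R of
        None \<Rightarrow> R = []
      | Some v \<Rightarrow> peels k n (remove1 v R) (bump (\<lambda>u. k u v) s))"

text \<open>The relations k and m bound the adjacency relation from below and from above.\<close>

fun valid :: "(nat \<Rightarrow> nat \<Rightarrow> bool) \<Rightarrow> (nat \<Rightarrow> nat \<Rightarrow> bool) \<Rightarrow> strategy \<Rightarrow> nat list \<Rightarrow> nat list \<Rightarrow> bool" where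
  "valid k m Greedy R s \<longleftrightarrow> peels k (length R) R s"
| "valid k m (Pair x y z p q r) R s \<longleftrightarrow>
     x \<in> set R \<and> y \<in> set R \<and> z \<in> set R \<and> x \<noteq> y \<and> \<not> m x y \<and> k z x \<and> k z y \<and>
     length (filter (m z) R) + s ! z + 1
       < length (filter (k x) R) + s ! x + (length (filter (k y) R) + s ! y) \<and>
     valid k m p (remove1 y (remove1 x R)) (bump (\<lambda>u. k u x \<and> k u y) s) \<and>
     valid k m q (remove1 x R) (bump (\<lambda>u. u = z) s) \<and>
     valid k m r (remove1 y R) (bump (\<lambda>u. u = z) s)"

lemma nth_bump: "u < length s \<Longrightarrow> bump p s ! u = s ! u + (if p u then 1 else 0)"
  by (simp add: bump_def)

lemma length_bump [simp]: "length (bump p s) = length s"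
  by (simp add: bump_def)

lemma peels_sound:
  assumes A: "symp A" "irreflp A"
    and k: "\<And>u v. u < n \<Longrightarrow> v < n \<Longrightarrow> k u v \<Longrightarrow> A u v"
  shows "peels k f R s \<Longrightarrow> distinct R \<Longrightarrow> set R \<subseteq> {..<n} \<Longrightarrow> length s = n \<Longrightarrow>
    slack_colorable A (set R) (\<lambda>v. s ! v)"
proof (induction f arbitrary: R s)
  case 0
  then show ?case by (simp add: slack_colorable_def list_colorable_def)
next
  case (Suc f)
  show ?case
  proof (cases "find (\<lambda>v. 2 \<le> s ! v) R")
    case None
    with Suc.prems show ?thesis by (simp add: slack_colorable_def list_colorable_def)
  next
    case (Some v)
    then have v: "v \<in> set R" "2 \<le> s ! v" by (auto simp: find_Some_iff)
    have "slack_colorable A (set (remove1 v R)) (\<lambda>u. bump (\<lambda>u. k u v) s ! u)"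
      by (rule Suc.IH) (use Suc.prems Some in \<open>auto\<close>)
    then have "slack_colorable A (set R - {v}) (\<lambda>u. bump (\<lambda>u. k u v) s ! u)"
      using Suc.prems by simp
    then show ?thesis
      by (rule slack_colorable_peel[OF A _ v(1), rotated 2])
        (use Suc.prems v k in \<open>auto simp: nth_bump subset_iff\<close>)
  qed
qed

lemma valid_sound:
  assumes A: "symp A" "irreflp A"
    and k: "\<And>u v. u < n \<Longrightarrow> v < n \<Longrightarrow> k u v \<Longrightarrow> A u v"
    and m: "\<And>u v. u < n \<Longrightarrow> v < n \<Longrightarrow> A u v \<Longrightarrow> m u v"
  shows "valid k m t R s \<Longrightarrow> distinct R \<Longrightarrow> set R \<subseteq> {..<n} \<Longrightarrow> length s = n \<Longrightarrow>
    slack_colorable A (set R) (\<lambda>v. s ! v)"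
proof (induction t arbitrary: R s)
  case Greedy
  then show ?case using peels_sound[OF A, of n k] k by simp
next
  case (Pair x y z p q r)
  have R: "v < n" if "v \<in> set R" for v using that Pair.prems by auto
  have xyz: "x \<in> set R" "y \<in> set R" "z \<in> set R" "x \<noteq> y" "\<not> m x y" "k z x" "k z y"
    using Pair.prems by auto
  \<comment> \<open>The size test must survive incomplete knowledge: \<open>k\<close> estimates the
    degrees of \<open>x\<close> and \<open>y\<close> from below, \<open>m\<close> that of
    \<open>z\<close> from above.\<close>
  have lower: "length (filter (k v) R) \<le> degree_in A (set R) v" if "v \<in> set R" for v
  proof -
    have "length (filter (k v) R) = card {u \<in> set R. k v u}"
      using distinct_card[of "filter (k v) R"] Pair.prems by simp
    also have "\<dots> \<le> card {u \<in> set R. A v u}"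
      using k that R by (intro card_mono) auto
    finally show ?thesis by (simp add: degree_in_def)
  qed
  have upper: "degree_in A (set R) z \<le> length (filter (m z) R)"
  proof -
    have "card {u \<in> set R. A z u} \<le> card {u \<in> set R. m z u}"
      using m xyz R by (intro card_mono) auto
    also have "\<dots> = length (filter (m z) R)"
      using distinct_card[of "filter (m z) R"] Pair.prems by simp
    finally show ?thesis by (simp add: degree_in_def)
  qed
  show ?case
  proof (rule slack_colorable_pair[OF A _ xyz(1-3)])
    show "x \<noteq> y" by (fact xyz)
    show "\<not> A x y" "A z x" "A z y" using xyz k m R by blast+
    show "degree_in A (set R) z + s ! z + 1
        < degree_in A (set R) x + s ! x + (degree_in A (set R) y + s ! y)"
      using Pair.prems(1) lower[OF xyz(1)] lower[OF xyz(2)] upper by auto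
    have "slack_colorable A (set (remove1 y (remove1 x R))) (\<lambda>u. bump (\<lambda>u. k u x \<and> k u y) s ! u)"
      by (rule Pair.IH) (use Pair.prems in auto)
    then show "slack_colorable A (set R - {x} - {y}) (\<lambda>u. bump (\<lambda>u. k u x \<and> k u y) s ! u)"
      using Pair.prems by simp
    have "slack_colorable A (set (remove1 x R)) (\<lambda>u. bump (\<lambda>u. u = z) s ! u)"
      by (rule Pair.IH) (use Pair.prems in auto)
    then show "slack_colorable A (set R - {x}) (\<lambda>u. bump (\<lambda>u. u = z) s ! u)"
      using Pair.prems by simp
    have "slack_colorable A (set (remove1 y R)) (\<lambda>u. bump (\<lambda>u. u = z) s ! u)"
      by (rule Pair.IH) (use Pair.prems in auto)
    then show "slack_colorable A (set R - {y}) (\<lambda>u. bump (\<lambda>u. u = z) s ! u)"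
      using Pair.prems by simp
    show "bump (\<lambda>u. k u x \<and> k u y) s ! u \<le> s ! u + (if A u x \<and> A u y then 1 else 0)"
      if "u \<in> set R" for u
      using that xyz k R Pair.prems by (auto simp: nth_bump)
    show "bump (\<lambda>u. u = z) s ! u \<le> s ! u + (if u = z then 1 else 0)" if "u \<in> set R" for u
      using that R Pair.prems by (simp add: nth_bump)
  qed simp
qed

section \<open>The configuration around a triangle\<close>

text \<open>The twelve edges of a triangle u v x and of the outer triangles u a b, v c d, x y z at its
  vertices are numbered vx, ux, uv, ab, cd, yz, ua, ub, vc, vd, xy, xz. The pairs in
  \<open>cross_far_pairs\<close> may be in conflict if two of the outer triangles are joined by an edge.
  The strategies were found by computer search.\<close>

definition near_pairs :: "(nat \<times> nat) list" where
  "near_pairs =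
    [(0,1), (0,2), (0,4), (0,5), (0,6), (0,7), (1,2), (1,3), (1,5), (1,8), (1,9), (2,3), (2,4),
     (2,10), (2,11), (3,6), (3,7), (4,8), (4,9), (5,10), (5,11), (6,7), (6,8), (6,9), (6,10),
     (6,11), (7,8), (7,9), (7,10), (7,11), (8,9), (8,10), (8,11), (9,10), (9,11), (10,11)]"

text \<open>Together with \<open>near_pairs\<close> and \<open>cross_far_pairs\<close> this
  partitions the 66 pairs of the twelve edges.\<close>

definition far_pairs :: "(nat \<times> nat) list" where
  "far_pairs =
    [(0,3), (0,8), (0,9), (0,10), (0,11), (1,4), (1,6), (1,7), (1,10), (1,11), (2,5), (2,6), (2,7),
     (2,8), (2,9)]"

definition cross_far_pairs :: "(nat \<times> nat) list" where
  "cross_far_pairs =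
    [(3,4), (3,5), (3,8), (3,9), (3,10), (3,11), (4,5), (4,6), (4,7), (4,10), (4,11), (5,6), (5,7),
     (5,8), (5,9)]"

definition sym_mem :: "(nat \<times> nat) list \<Rightarrow> nat \<Rightarrow> nat \<Rightarrow> bool" where
  "sym_mem ps i j \<longleftrightarrow> (i, j) \<in> set ps \<or> (j, i) \<in> set ps"

definition separated_strategy :: strategy where
  "separated_strategy =
    Pair 0 3 6
      (Pair 1 6 8 (Pair 4 7 8 Greedy Greedy Greedy) (Pair 4 6 8 Greedy Greedy Greedy)
        (Pair 1 7 8 Greedy Greedy Greedy))
      (Pair 1 7 8 (Pair 3 8 6 Greedy Greedy Greedy) (Pair 3 9 6 Greedy Greedy Greedy)
        (Pair 1 10 8 Greedy Greedy Greedy))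
      (Pair 0 8 6 Greedy (Pair 1 7 8 Greedy Greedy Greedy) (Pair 0 9 7 Greedy Greedy Greedy))"

definition square_strategy :: strategy where
  "square_strategy =
    Pair 0 3 1 Greedy (Pair 2 5 1 Greedy Greedy Greedy) (Pair 0 8 1 Greedy Greedy Greedy)"

lemma valid_separated_strategy:
  "valid (sym_mem near_pairs) (\<lambda>i j. i \<noteq> j \<and> \<not> sym_mem (far_pairs @ cross_far_pairs) i j)
     separated_strategy [0..<12] (replicate 12 0)"
  by code_simp

text \<open>Slack 1 goes to uv, ua and vc. The three added pairs, ab-cd, ab-vc and cd-ua, are the
  conflicts forced by an edge ac; the other pairs of \<open>cross_far_pairs\<close> are left
  undecided.\<close>

lemma valid_square_strategy:
  "valid (sym_mem (near_pairs @ [(3,4), (3,8), (4,6)])) (\<lambda>i j. i \<noteq> j \<and> \<not> sym_mem far_pairs i j)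
     square_strategy [0..<12] [0,0,1,0,0,0,1,0,1,0,0,0]"
  by code_simp

lemma slack_colorable_strategy:
  assumes A: "symp A" "irreflp A"
    and near: "\<forall>(i, j) \<in> set near. A i j" and far: "\<forall>(i, j) \<in> set far. \<not> A i j"
    and valid: "valid (sym_mem near) (\<lambda>i j. i \<noteq> j \<and> \<not> sym_mem far i j) t [0..<12] s"
    and len: "length s = 12"
  shows "slack_colorable A {..<12} (\<lambda>i. s ! i)"
proof -
  have "slack_colorable A (set [0..<12]) (\<lambda>i. s ! i)"
  proof (rule valid_sound[OF A _ _ valid])
    show "A i j" if "sym_mem near i j" for i j
      using that near sympD[OF A(1)] by (auto simp: sym_mem_def)
    show "i \<noteq> j \<and> \<not> sym_mem far i j" if "A i j" for i j
    proof
      show "i \<noteq> j" using that irreflpD[OF A(2)] by blast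
      show "\<not> sym_mem far i j" using that far sympD[OF A(1)] by (auto simp: sym_mem_def)
    qed
  qed (auto simp: len)
  moreover have "set [0..<12] = {..<12::nat}" by auto
  ultimately show ?thesis by simp
qed

section \<open>Counting conflicts\<close>

locale claw_free_degree_4 = finite_simple_graph V E for V :: "'a set" and E :: "'a set set" +
  assumes claw:
    "\<lbrakk>{v, a} \<in> E; {v, b} \<in> E; {v, c} \<in> E; a \<noteq> b; a \<noteq> c; b \<noteq> c\<rbrakk> \<Longrightarrow>
     {a, b} \<in> E \<or> {a, c} \<in> E \<or> {b, c} \<in> E"
    and degree_le: "degree E v \<le> 4"
begin

definition nbrs :: "'a \<Rightarrow> 'a set" where
  "nbrs v = {w. {v, w} \<in> E}"

text \<open>An edge of a triangle is \<open>in_common_triangle\<close> with itself; the disequality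
  makes the relation irreflexive.\<close>

definition conflict :: "'a set \<Rightarrow> 'a set \<Rightarrow> bool" where
  "conflict e f \<longleftrightarrow> e \<noteq> f \<and> (at_distance_two E e f \<or> in_common_triangle E e f)"

definition conflicts :: "'a set \<Rightarrow> 'a set set" where
  "conflicts e = {f \<in> E. conflict e f}"

lemma nbrs_iff [simp]: "w \<in> nbrs v \<longleftrightarrow> {v, w} \<in> E"
  by (simp add: nbrs_def)

lemma no_loop [simp]: "{v} \<notin> E"
  using edge_card by force

lemma edge_neq: "{u, v} \<in> E \<Longrightarrow> u \<noteq> v"
  by auto

lemma finite_edges [simp]: "finite E"
  using edge_subset finite_vertices by (metis Pow_iff finite_Pow_iff finite_subset subsetI)

lemma finite_conflicts [simp]: "finite (conflicts e)"
  by (simp add: conflicts_def)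

lemma nbrs_subset: "nbrs v \<subseteq> V"
  using edge_subset by (force simp: nbrs_def)

lemma finite_nbrs [simp]: "finite (nbrs v)"
  using nbrs_subset finite_vertices finite_subset by blast

lemma edge_cases:
  assumes "e \<in> E"
  obtains u v where "e = {u, v}" "u \<noteq> v" "{u, v} \<in> E"
  using edge_card[OF assms] assms by (metis card_2_iff)

lemma card_nbrs: "card (nbrs v) = degree E v"
proof -
  have "{e \<in> E. v \<in> e} = (\<lambda>w. {v, w}) ` nbrs v"
  proof (intro equalityI subsetI)
    fix e assume e: "e \<in> {e \<in> E. v \<in> e}"
    then obtain p q where "e = {p, q}" using edge_cases by blast
    then show "e \<in> (\<lambda>w. {v, w}) ` nbrs v" using e by (auto simp: insert_commute)
  qed auto
  moreover have "inj_on (\<lambda>w. {v, w}) (nbrs v)"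
    by (auto simp: inj_on_def doubleton_eq_iff)
  ultimately show ?thesis
    by (simp add: degree_def card_image)
qed

lemma card_nbrs_le: "card (nbrs v) \<le> 4"
  by (simp add: card_nbrs degree_le)

lemma at_distance_two_sym: "at_distance_two E e f \<Longrightarrow> at_distance_two E f e"
  unfolding at_distance_two_def by (metis inf_commute insert_commute)

lemma in_common_triangle_sym: "in_common_triangle E e f \<Longrightarrow> in_common_triangle E f e"
  unfolding in_common_triangle_def by blast

lemma conflict_sym: "conflict e f \<longleftrightarrow> conflict f e"
  unfolding conflict_def using at_distance_two_sym in_common_triangle_sym by metis

lemma conflict_disjoint:
  assumes "p \<noteq> r" "p \<noteq> s" "q \<noteq> r" "q \<noteq> s"
  shows "conflict {p, q} {r, s} \<longleftrightarrow> {p, r} \<in> E \<or> {p, s} \<in> E \<or> {q, r} \<in> E \<or> {q, s} \<in> E"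
proof -
  have "\<not> in_common_triangle E {p, q} {r, s}"
    using assms unfolding in_common_triangle_def by (auto simp: doubleton_eq_iff)
  then show ?thesis
    using assms by (auto simp: conflict_def at_distance_two_def doubleton_eq_iff)
qed

lemma conflict_share:
  assumes "{p, q} \<in> E" "{p, r} \<in> E" "q \<noteq> r"
  shows "conflict {p, q} {p, r} \<longleftrightarrow> {q, r} \<in> E"
proof
  assume "conflict {p, q} {p, r}"
  then have "in_common_triangle E {p, q} {p, r}"
    by (auto simp: conflict_def at_distance_two_def)
  then show "{q, r} \<in> E"
    using assms(3) unfolding in_common_triangle_def
    by (auto simp: doubleton_eq_iff insert_commute)
next
  assume "{q, r} \<in> E"
  then have "in_common_triangle E {p, q} {p, r}"
    using assms edge_neq[OF assms(1)] edge_neq[OF assms(2)]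
    unfolding in_common_triangle_def by blast
  then show "conflict {p, q} {p, r}"
    using assms(3) by (auto simp: conflict_def doubleton_eq_iff)
qed

lemma conflict_share':
  assumes "{p, q} \<in> E" "{p, r} \<in> E" "q \<noteq> r"
  shows "conflict {p, q} {r, p} \<longleftrightarrow> {q, r} \<in> E" "conflict {q, p} {p, r} \<longleftrightarrow> {q, r} \<in> E"
    "conflict {q, p} {r, p} \<longleftrightarrow> {q, r} \<in> E"
  using conflict_share[OF assms] by (simp_all add: insert_commute)

text \<open>An edge that meets \<open>{u, v}\<close> in one vertex conflicts with it only if the two
  span a triangle, and then its other end is a common neighbour.\<close>

lemma conflicts_subset:
  assumes uv: "{u, v} \<in> E" and C: "C = nbrs u \<inter> nbrs v"
  shows "conflicts {u, v} \<subseteq> (\<lambda>x. {u, x}) ` C \<union> (\<lambda>x. {v, x}) ` C \<union>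
    {f \<in> E. f \<inter> {u, v} = {} \<and> f \<inter> (nbrs u \<union> nbrs v) \<noteq> {}}"
proof
  fix f assume "f \<in> conflicts {u, v}"
  then have f: "f \<in> E" "conflict {u, v} f" by (auto simp: conflicts_def)
  obtain r s where rs: "f = {r, s}" "{r, s} \<in> E" "r \<noteq> s" using f(1) by (auto elim: edge_cases)
  have uv': "u \<noteq> v" "f \<noteq> {u, v}" using uv edge_neq f(2) by (auto simp: conflict_def)
  consider (disj) "f \<inter> {u, v} = {}" | (u) w where "f = {u, w}" "w \<noteq> v" | (v) w where "f = {v, w}" "w \<noteq> u"
    using rs(1) uv'(2) by (auto simp: insert_commute)
  then show "f \<in> (\<lambda>x. {u, x}) ` C \<union> (\<lambda>x. {v, x}) ` C \<union>
      {f \<in> E. f \<inter> {u, v} = {} \<and> f \<inter> (nbrs u \<union> nbrs v) \<noteq> {}}"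
  proof cases
    case disj
    then have "u \<noteq> r" "u \<noteq> s" "v \<noteq> r" "v \<noteq> s" using rs(1) by auto
    then have "{u, r} \<in> E \<or> {u, s} \<in> E \<or> {v, r} \<in> E \<or> {v, s} \<in> E"
      using f(2) rs(1) conflict_disjoint by blast
    then show ?thesis using disj f(1) rs(1) by auto
  next
    case u
    then have "{v, w} \<in> E" using conflict_share[of u v w] f uv by auto
    then show ?thesis using u f(1) C by auto
  next
    case v
    then have "{u, w} \<in> E" using conflict_share[of v u w] f uv by (auto simp: insert_commute)
    then show ?thesis using v f(1) C by auto
  qed
qed

text \<open>Double counting of the pairs of an edge and an endpoint of it in the neighbourhood of
  \<open>{u, v}\<close>; the private neighbours of u form a clique, as do those of v, because there is no
  claw.\<close>

lemma card_conflicts_bound: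
  assumes uv: "{u, v} \<in> E"
    and C: "C = nbrs u \<inter> nbrs v" and P: "P = nbrs u - nbrs v - {v}" and Q: "Q = nbrs v - nbrs u - {u}"
    and F: "F \<subseteq> E" "\<And>f. f \<in> F \<Longrightarrow> f \<subseteq> C \<union> P \<union> Q" "\<And>f. f \<in> F \<Longrightarrow> \<not> f \<subseteq> P" "\<And>f. f \<in> F \<Longrightarrow> \<not> f \<subseteq> Q"
  shows "card (conflicts {u, v}) + card F + (card P choose 2) + (card Q choose 2)
           \<le> 3 * card P + 3 * card Q + 4 * card C"
proof -
  define X where "X = C \<union> P \<union> Q"
  \<comment> \<open>\<open>S\<close> and \<open>T\<close> are the spokes from \<open>u\<close> and
    \<open>v\<close> into the neighbourhood \<open>X\<close>, \<open>I\<close> the other edges that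
    meet \<open>X\<close>, and \<open>J\<close> those among them with both ends in \<open>X\<close>.
    Summing degrees over \<open>X\<close> counts the edges of \<open>J\<close> twice.\<close>
  define I where "I = {f \<in> E. f \<inter> {u, v} = {} \<and> f \<inter> X \<noteq> {}}"
  define J where "J = {f \<in> E. f \<subseteq> X}"
  define S where "S = (\<lambda>x. {u, x}) ` (C \<union> P)"
  define T where "T = (\<lambda>x. {v, x}) ` (C \<union> Q)"
  have fin: "finite C" "finite P" "finite Q" "finite X" "finite I" "finite J" "finite S" "finite T"
    by (auto simp: C P Q X_def I_def J_def S_def T_def)
  have uv': "u \<noteq> v" using uv by auto
  have uX: "u \<notin> X" "v \<notin> X" by (auto simp: X_def C P Q)
  have disj: "C \<inter> P = {}" "C \<inter> Q = {}" "P \<inter> Q = {}" by (auto simp: C P Q)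
  have cardX: "card X = card C + card P + card Q"
    unfolding X_def using fin disj by (simp add: card_Un_disjoint Int_Un_distrib2)
  have cardS: "card S = card C + card P"
    unfolding S_def using fin disj
    by (subst card_image) (auto simp: inj_on_def doubleton_eq_iff card_Un_disjoint)
  have cardT: "card T = card C + card Q"
    unfolding T_def using fin disj
    by (subst card_image) (auto simp: inj_on_def doubleton_eq_iff card_Un_disjoint)
  have edge_ne: "f \<noteq> {}" if "f \<in> E" for f using edge_card[OF that] by auto
  have JI: "J \<subseteq> I" using uX edge_ne by (auto simp: J_def I_def)
  have X_eq: "X = nbrs u \<union> nbrs v - {u, v}" using uv by (auto simp: X_def C P Q insert_commute)
  have "conflicts {u, v} \<subseteq> (\<lambda>x. {u, x}) ` C \<union> (\<lambda>x. {v, x}) ` C \<union> I"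
    using conflicts_subset[OF uv C] X_eq by (auto simp: I_def)
  then have "card (conflicts {u, v}) \<le> card ((\<lambda>x. {u, x}) ` C \<union> (\<lambda>x. {v, x}) ` C \<union> I)"
    using fin by (intro card_mono) auto
  also have "\<dots> \<le> card ((\<lambda>x. {u, x}) ` C) + card ((\<lambda>x. {v, x}) ` C) + card I"
    by (meson add_le_mono1 card_Un_le le_trans)
  also have "\<dots> \<le> card C + card C + card I"
    by (intro add_mono card_image_le fin order_refl)
  finally have conf: "card (conflicts {u, v}) \<le> 2 * card C + card I" by simp
  have ST: "S \<inter> T = {}" "S \<inter> I = {}" "T \<inter> I = {}" "S \<union> T \<union> I \<subseteq> E"
    using uv' uX by (auto simp: S_def T_def I_def C P Q X_def doubleton_eq_iff)
  have one: "1 \<le> card (f \<inter> X)" if "f \<in> S \<union> T" for f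
    using that fin by (auto simp: S_def T_def X_def Suc_le_eq card_gt_0_iff)
  have two: "1 + (if f \<in> J then 1 else 0) \<le> card (f \<inter> X)" if "f \<in> I" for f
  proof (cases "f \<in> J")
    case True
    then have "f \<inter> X = f" "card f = 2" using edge_card by (auto simp: J_def)
    then show ?thesis by simp
  next
    case False
    then show ?thesis using that fin by (auto simp: I_def Suc_le_eq card_gt_0_iff)
  qed
  have "card S + card T + (card I + card J) = (\<Sum>f\<in>S. 1) + (\<Sum>f\<in>T. 1) + (\<Sum>f\<in>I. 1 + (if f \<in> J then 1 else 0))"
    using fin JI by (simp only: sum.distrib) (simp add: sum.If_cases Int_absorb1)
  also have "\<dots> \<le> (\<Sum>f\<in>S. card (f \<inter> X)) + (\<Sum>f\<in>T. card (f \<inter> X)) + (\<Sum>f\<in>I. card (f \<inter> X))"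
    using one two by (intro add_mono sum_mono) auto
  also have "\<dots> = (\<Sum>f\<in>S \<union> T \<union> I. card (f \<inter> X))"
    using fin ST by (simp add: sum.union_disjoint Int_Un_distrib2)
  also have "\<dots> \<le> (\<Sum>f\<in>E. card (f \<inter> X))"
    using ST by (intro sum_mono2) auto
  also have "\<dots> = (\<Sum>f\<in>E. \<Sum>x\<in>X. if x \<in> f then 1 else 0)"
    using fin by (intro sum.cong) (auto simp: sum.If_cases Int_commute Collect_mem_eq)
  also have "\<dots> = (\<Sum>x\<in>X. \<Sum>f\<in>E. if x \<in> f then 1 else 0)"
    by (rule sum.swap)
  also have "\<dots> = (\<Sum>x\<in>X. degree E x)"
    unfolding degree_def by (intro sum.cong) (auto simp: sum.If_cases intro: arg_cong[where f = card])
  also have "\<dots> \<le> (\<Sum>x\<in>X. 4)"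
    by (intro sum_mono degree_le)
  finally have count: "card S + card T + (card I + card J) \<le> 4 * card X" by simp
  have clique: "{f. f \<subseteq> P \<and> card f = 2} \<subseteq> E" "{f. f \<subseteq> Q \<and> card f = 2} \<subseteq> E"
  proof -
    have "{a, b} \<in> E" if "a \<in> P" "b \<in> P" "a \<noteq> b" for a b
      using claw[of u v a b] that uv by (auto simp: P)
    then show "{f. f \<subseteq> P \<and> card f = 2} \<subseteq> E" by (auto simp: card_2_iff)
    have "{a, b} \<in> E" if "a \<in> Q" "b \<in> Q" "a \<noteq> b" for a b
      using claw[of v u a b] that uv by (auto simp: Q insert_commute)
    then show "{f. f \<subseteq> Q \<and> card f = 2} \<subseteq> E" by (auto simp: card_2_iff)
  qed
  have "F \<union> {f. f \<subseteq> P \<and> card f = 2} \<union> {f. f \<subseteq> Q \<and> card f = 2} \<subseteq> J"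
    using clique F(1,2) unfolding J_def X_def by blast
  then have "card (F \<union> {f. f \<subseteq> P \<and> card f = 2} \<union> {f. f \<subseteq> Q \<and> card f = 2}) \<le> card J"
    using fin by (intro card_mono)
  moreover have "card (F \<union> {f. f \<subseteq> P \<and> card f = 2} \<union> {f. f \<subseteq> Q \<and> card f = 2}) =
      card F + (card P choose 2) + (card Q choose 2)"
  proof -
    have "finite F" using F(1) finite_edges finite_subset by blast
    moreover have "finite {f. f \<subseteq> P \<and> card f = 2}" "finite {f. f \<subseteq> Q \<and> card f = 2}"
      using fin by auto
    moreover have "F \<inter> {f. f \<subseteq> P \<and> card f = 2} = {}" using F(3) by auto
    moreover have "(F \<union> {f. f \<subseteq> P \<and> card f = 2}) \<inter> {f. f \<subseteq> Q \<and> card f = 2} = {}"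
    proof -
      have "card f \<noteq> 2" if "f \<subseteq> P" "f \<subseteq> Q" for f
      proof -
        have "f = {}" using that disj(3) by auto
        then show ?thesis by simp
      qed
      then show ?thesis using F(4) by blast
    qed
    ultimately show ?thesis
      using n_subsets[OF fin(2), of 2] n_subsets[OF fin(3), of 2] by (simp add: card_Un_disjoint)
  qed
  \<comment> \<open>The degree count leaves at most
    \<open>2 * card C + 3 * card P + 3 * card Q\<close> for \<open>card I + card J\<close>, and the
    conflicting spokes add \<open>2 * card C\<close>. The edges of \<open>F\<close> and of the two
    cliques are all in \<open>J\<close>.\<close>
  ultimately show ?thesis
    using conf count cardS cardT cardX by linarith
qed

text \<open>The bound is 4c + f(p) + f(q), with f taking the values 0, 3, 5, 6 at 0, 1, 2, 3, where
  c + p and c + q are at most 3. It is at most 12 for c = 0 and c = 3. For c = 1 and c = 2 it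
  reaches 14, and only when p and q are as large as possible; otherwise it is at most 12.\<close>

lemma many_conflicts_cases:
  assumes uv: "{u, v} \<in> E" and "13 \<le> card (conflicts {u, v})"
    and C: "C = nbrs u \<inter> nbrs v" and P: "P = nbrs u - nbrs v - {v}" and Q: "Q = nbrs v - nbrs u - {u}"
  shows "card C = 1 \<and> card P = 2 \<and> card Q = 2 \<or> card C = 2 \<and> card P = 1 \<and> card Q = 1"
proof -
  have fin: "finite C" "finite P" "finite Q" by (auto simp: C P Q)
  have "C \<union> P \<union> {v} = nbrs u" "C \<inter> P = {}" "v \<notin> C \<union> P" "C \<union> Q \<union> {u} = nbrs v" "C \<inter> Q = {}" "u \<notin> C \<union> Q"
    using uv by (auto simp: C P Q insert_commute)
  then have "card (nbrs u) = card C + card P + 1" "card (nbrs v) = card C + card Q + 1"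
    using fin card_Un_disjoint[of C P] card_Un_disjoint[of C Q]
      card_insert_disjoint[of "C \<union> P" v] card_insert_disjoint[of "C \<union> Q" u] by auto
  then have "card C + card P \<le> 3" "card C + card Q \<le> 3"
    using card_nbrs_le[of u] card_nbrs_le[of v] by auto
  moreover have "13 + (card P choose 2) + (card Q choose 2) \<le> 3 * card P + 3 * card Q + 4 * card C"
    using card_conflicts_bound[OF uv C P Q, of "{}"] assms(2) by simp
  moreover have "card P \<in> {0, 1, 2, 3}" "card Q \<in> {0, 1, 2, 3}"
    using calculation by auto
  ultimately show ?thesis
    by (auto simp: choose_two)
qed

end

section \<open>Edges with many conflicts\<close>

context claw_free_degree_4
begin

text \<open>This is the neighbourhood of a vertex in the line graph of a triangle-free cubic graph:
  two triangles that meet in \<open>u\<close>, with no further edge between them.\<close>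

definition hinge :: "'a \<Rightarrow> 'a \<Rightarrow> 'a \<Rightarrow> 'a \<Rightarrow> 'a \<Rightarrow> bool" where
  "hinge u v x a b \<longleftrightarrow> nbrs u = {v, x, a, b} \<and> distinct [v, x, a, b] \<and> {v, x} \<in> E \<and> {a, b} \<in> E \<and>
     {v, a} \<notin> E \<and> {v, b} \<notin> E \<and> {x, a} \<notin> E \<and> {x, b} \<notin> E"

definition hinged :: "'a \<Rightarrow> 'a \<Rightarrow> 'a \<Rightarrow> bool" where
  "hinged u v x \<longleftrightarrow> (\<exists>a b. hinge u v x a b) \<and> (\<exists>c d. hinge v u x c d) \<and> (\<exists>y z. hinge x u v y z)"

lemma hinge_swap:
  assumes "hinge u v x a b"
  shows hinge_swap_left: "hinge u x v a b" and hinge_swap_right: "hinge u v x b a"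
    and hinge_swap_sides: "hinge u a b v x"
  using assms by (auto simp: hinge_def insert_commute)

lemma hinge_edges:
  assumes "hinge u v x a b"
  shows "{u, v} \<in> E" "{u, x} \<in> E" "{u, a} \<in> E" "{u, b} \<in> E" "{v, x} \<in> E" "{a, b} \<in> E"
proof -
  have "v \<in> nbrs u" "x \<in> nbrs u" "a \<in> nbrs u" "b \<in> nbrs u"
    using assms by (auto simp: hinge_def simp del: nbrs_iff)
  then show "{u, v} \<in> E" "{u, x} \<in> E" "{u, a} \<in> E" "{u, b} \<in> E" by simp_all
  show "{v, x} \<in> E" "{a, b} \<in> E" using assms by (auto simp: hinge_def)
qed

lemma hinge_nbr: "hinge u v x a b \<Longrightarrow> {u, w} \<in> E \<longleftrightarrow> w \<in> {v, x, a, b}"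
  unfolding hinge_def by (metis nbrs_iff)

text \<open>One common neighbour and two private ones on each side give 4 + 6 + 6, minus the two
  edges inside the private pairs, which is 14. Each edge between the private pairs lowers the bound
  by one.\<close>

lemma card_conflicts_hinge:
  assumes h: "hinge p q r s t" "hinge q p r s' t'"
    and F: "F \<subseteq> E" "\<And>f. f \<in> F \<Longrightarrow> \<exists>i\<in>{s, t}. \<exists>j\<in>{s', t'}. f = {i, j}"
  shows "card (conflicts {p, q}) + card F \<le> 14"
proof -
  have e: "{p, q} \<in> E" "p \<noteq> q" using hinge_edges[OF h(1)] edge_neq by auto
  have n: "nbrs p = {q, r, s, t}" "nbrs q = {p, r, s', t'}" using h by (auto simp: hinge_def)
  have d: "distinct [q, r, s, t]" "distinct [p, r, s', t']" using h by (auto simp: hinge_def)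
  have st: "s \<notin> nbrs q" "t \<notin> nbrs q" "s' \<notin> nbrs p" "t' \<notin> nbrs p"
    using h by (auto simp: hinge_def)
  have C: "{r} = nbrs p \<inter> nbrs q" and P: "{s, t} = nbrs p - nbrs q - {q}"
    and Q: "{s', t'} = nbrs q - nbrs p - {p}"
    using st d e(2) unfolding n by auto
  have "s \<noteq> s'" "s \<noteq> t'" "t \<noteq> s'" "t \<noteq> t'" using st unfolding n by auto
  then have "card (conflicts {p, q}) + card F + (card {s, t} choose 2) + (card {s', t'} choose 2)
      \<le> 3 * card {s, t} + 3 * card {s', t'} + 4 * card {r}"
    by (intro card_conflicts_bound[OF e(1) C P Q F(1)]) (use F(2) in fastforce)+
  then show ?thesis using d by (simp add: choose_two)
qed

lemma card_conflicts_hinge_14: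
  "hinge p q r s t \<Longrightarrow> hinge q p r s' t' \<Longrightarrow> card (conflicts {p, q}) \<le> 14"
  using card_conflicts_hinge[of p q r s t s' t' "{}"] by simp

lemma card_conflicts_hinge_13:
  assumes "hinge p q r s t" "hinge q p r s' t'" "{i, j} \<in> E" "i \<in> {s, t}" "j \<in> {s', t'}"
  shows "card (conflicts {p, q}) \<le> 13"
  using card_conflicts_hinge[OF assms(1,2), of "{{i, j}}"] assms(3-5) by auto

lemma hinged_sym: "hinged u v x \<longleftrightarrow> hinged v u x" "hinged u v x \<longleftrightarrow> hinged u x v"
  unfolding hinged_def by (blast dest: hinge_swap_left)+

lemma card_conflicts_hinged: "hinged u v x \<Longrightarrow> card (conflicts {u, v}) \<le> 14"
  unfolding hinged_def using card_conflicts_hinge_14 by blast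

lemma symp_conflict: "symp conflict" and irreflp_conflict: "irreflp conflict"
  using conflict_sym by (auto simp: symp_def irreflp_def conflict_def)

end

section \<open>A minimal uncolourable set of edges\<close>

locale critical = claw_free_degree_4 V E for V :: "'a set" and E :: "'a set set" +
  fixes W :: "'a set set"
  assumes W_edges: "W \<subseteq> E"
    and not_colorable: "\<not> list_colorable conflict W (\<lambda>_. {1..13::nat})"
    and proper_colorable: "F \<subset> W \<Longrightarrow> list_colorable conflict F (\<lambda>_. {1..13::nat})"
begin

lemma critical_degree:
  assumes e: "e \<in> W"
  shows "13 \<le> card (conflicts e \<inter> W)"
proof (rule ccontr)
  assume "\<not> 13 \<le> card (conflicts e \<inter> W)"
  then have few: "card (conflicts e \<inter> W) < 13" by simp
  obtain \<phi> where \<phi>: "\<forall>f\<in>W - {e}. \<phi> f \<in> {1..13::nat}"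
      "\<forall>f\<in>W - {e}. \<forall>g\<in>W - {e}. conflict f g \<longrightarrow> \<phi> f \<noteq> \<phi> g"
    using proper_colorable[of "W - {e}"] e unfolding list_colorable_def by blast
  have "card (\<phi> ` (conflicts e \<inter> W)) < card {1..13::nat}"
    using few card_image_le[of "conflicts e \<inter> W" \<phi>] by simp
  then have "\<not> {1..13::nat} \<subseteq> \<phi> ` (conflicts e \<inter> W)"
    using card_mono[of "\<phi> ` (conflicts e \<inter> W)" "{1..13::nat}"] by auto
  then obtain t where t: "t \<in> {1..13}" "t \<notin> \<phi> ` (conflicts e \<inter> W)" by blast
  have "list_colorable conflict W (\<lambda>_. {1..13::nat})"
  proof (rule list_colorable_insert[where x = e, OF symp_conflict irreflp_conflict t(1)])
    have "\<phi> f \<noteq> t" if "f \<in> W" "conflict f e" for f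
      using t(2) that W_edges conflict_sym by (auto simp: conflicts_def)
    then show "list_colorable conflict (W - {e})
        (\<lambda>u. if conflict u e then {1..13} - {t} else {1..13})"
      unfolding list_colorable_def using \<phi> by (intro exI[of _ \<phi>]) auto
  qed
  then show False using not_colorable by contradiction
qed

lemma critical_conflicts: "e \<in> W \<Longrightarrow> 13 \<le> card (conflicts e)"
  using critical_degree[of e] card_mono[of "conflicts e" "conflicts e \<inter> W"] by simp

lemma conflicts_subset_critical:
  assumes "e \<in> W" "card (conflicts e) \<le> 13"
  shows "conflicts e \<subseteq> W"
  using card_seteq[of "conflicts e" "conflicts e \<inter> W"] critical_degree[OF assms(1)] assms(2) by auto

text \<open>At least 13 of at most 14 conflicts lie in \<open>W\<close>, so at most one is missing.
  This passes membership in \<open>W\<close> on to nearby edges.\<close>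

lemma one_of_two_conflicts:
  assumes e: "e \<in> W" "card (conflicts e) \<le> 14" and f: "f \<in> conflicts e" "g \<in> conflicts e" "f \<noteq> g"
  shows "f \<in> W \<or> g \<in> W"
proof (rule ccontr)
  assume "\<not> (f \<in> W \<or> g \<in> W)"
  then have "conflicts e \<inter> W \<subseteq> conflicts e - {f, g}" by auto
  then have "card (conflicts e \<inter> W) \<le> card (conflicts e - {f, g})" by (intro card_mono) auto
  also have "\<dots> = card (conflicts e) - 2" using f by (simp add: card_Diff_subset)
  finally show False using critical_degree[OF e(1)] e(2) by simp
qed

text \<open>The count starts at 14 and must stay at 13 or more, so at most one edge joins the
  remaining neighbours. If \<open>x\<close> and \<open>y\<close> were not adjacent, avoiding claws
  at \<open>u\<close> and at \<open>v\<close> would need two such edges. So \<open>{x, y}\<close> is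
  the only one, and the 13 conflicts left are all in \<open>W\<close>.\<close>

lemma two_common_neighbours:
  assumes W: "{u, v} \<in> W" and two: "card (nbrs u \<inter> nbrs v) = 2"
  obtains x y a where "nbrs u \<inter> nbrs v = {x, y}" "x \<noteq> y" "nbrs u - nbrs v - {v} = {a}" "{x, y} \<in> E"
    "{x, a} \<notin> E" "{y, a} \<notin> E" "conflicts {u, v} \<subseteq> W"
proof -
  define C where "C = nbrs u \<inter> nbrs v"
  define P where "P = nbrs u - nbrs v - {v}"
  define Q where "Q = nbrs v - nbrs u - {u}"
  have uv: "{u, v} \<in> E" using W W_edges by auto
  have "card C = 2" "card P = 1" "card Q = 1"
    using many_conflicts_cases[OF uv critical_conflicts[OF W] C_def P_def Q_def] two by (auto simp: C_def)
  then obtain x y a c where C: "C = {x, y}" "x \<noteq> y" and P: "P = {a}" and Q: "Q = {c}"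
    by (auto simp: card_2_iff card_1_singleton_iff)
  have disj: "a \<notin> {x, y}" "c \<notin> {x, y}" "a \<noteq> c"
    using C(1) P Q unfolding C_def P_def Q_def by blast+
  have bound: "card (conflicts {u, v}) + card F \<le> 14"
    if F: "F \<subseteq> E" "\<And>f. f \<in> F \<Longrightarrow> f \<subseteq> {x, y, a, c} \<and> \<not> f \<subseteq> {a} \<and> \<not> f \<subseteq> {c}" for F
  proof -
    have "card (conflicts {u, v}) + card F + (card P choose 2) + (card Q choose 2)
        \<le> 3 * card P + 3 * card Q + 4 * card C"
      by (intro card_conflicts_bound[OF uv C_def P_def Q_def F(1)]) (use F(2) C P Q in fastforce)+
    then show ?thesis using C P Q by simp
  qed
  have nb: "{u, x} \<in> E" "{u, y} \<in> E" "{u, a} \<in> E" "{v, x} \<in> E" "{v, y} \<in> E" "{v, c} \<in> E"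
    using C(1) P Q unfolding C_def P_def Q_def set_eq_iff by auto
  have F2: "card F < 2"
    if "F \<subseteq> E" "\<And>f. f \<in> F \<Longrightarrow> f \<subseteq> {x, y, a, c} \<and> \<not> f \<subseteq> {a} \<and> \<not> f \<subseteq> {c}" for F
    using bound[OF that] critical_conflicts[OF W] by simp
  have xy: "{x, y} \<in> E"
  proof (rule ccontr)
    assume n: "{x, y} \<notin> E"
    obtain i where i: "i \<in> {x, y}" "{i, a} \<in> E" using claw[of u x y a] nb n C(2) disj by auto
    obtain j where j: "j \<in> {x, y}" "{j, c} \<in> E" using claw[of v x y c] nb n C(2) disj by auto
    have "{i, a} \<noteq> {j, c}" using i j disj by (auto simp: doubleton_eq_iff)
    moreover have "card {{i, a}, {j, c}} < 2" by (rule F2) (use i j disj in auto)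
    ultimately show False by simp
  qed
  have na: "{i, a} \<notin> E" if "i \<in> {x, y}" for i
  proof
    assume i: "{i, a} \<in> E"
    have "{x, y} \<noteq> {i, a}" using that disj by (auto simp: doubleton_eq_iff)
    moreover have "card {{x, y}, {i, a}} < 2" by (rule F2) (use i xy that disj C(2) in auto)
    ultimately show False by simp
  qed
  have "card (conflicts {u, v}) + card {{x, y}} \<le> 14" by (rule bound) (use xy disj in auto)
  then have "conflicts {u, v} \<subseteq> W" using conflicts_subset_critical[OF W] by simp
  then show thesis using that[of x y a] C P xy na unfolding C_def P_def by blast
qed

text \<open>Two common neighbours \<open>x\<close>, \<open>y\<close> would make u, v, x, y a
  complete graph. Then \<open>{v, x}\<close> is in \<open>W\<close> and again has two common
  neighbours, so its conflict \<open>{u, a}\<close> is in \<open>W\<close>. But \<open>a\<close> is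
  adjacent to no other neighbour of \<open>u\<close>, so \<open>{u, a}\<close> lies in no triangle,
  contrary to the possible cases.\<close>

lemma unique_common_neighbour:
  assumes W: "{u, v} \<in> W"
  shows "card (nbrs u \<inter> nbrs v) = 1" "card (nbrs u - nbrs v - {v}) = 2" "card (nbrs v - nbrs u - {u}) = 2"
proof -
  have cases: "card (nbrs p \<inter> nbrs q) = 1 \<and> card (nbrs p - nbrs q - {q}) = 2 \<and> card (nbrs q - nbrs p - {p}) = 2 \<or>
      card (nbrs p \<inter> nbrs q) = 2" if "{p, q} \<in> W" for p q
    using many_conflicts_cases[OF _ critical_conflicts[OF that] refl refl refl] that W_edges by blast
  have "card (nbrs u \<inter> nbrs v) \<noteq> 2"
  proof
    assume "card (nbrs u \<inter> nbrs v) = 2"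
    from two_common_neighbours[OF W this] obtain x y a where
      C: "nbrs u \<inter> nbrs v = {x, y}" "x \<noteq> y" and P: "nbrs u - nbrs v - {v} = {a}"
      and xy: "{x, y} \<in> E" "{x, a} \<notin> E" "{y, a} \<notin> E" and sub: "conflicts {u, v} \<subseteq> W" .
    have uv: "{u, v} \<in> E" using W W_edges by auto
    have nb: "{u, x} \<in> E" "{u, y} \<in> E" "{v, x} \<in> E" "{v, y} \<in> E" "{u, a} \<in> E" "{v, a} \<notin> E" "a \<noteq> v"
      using C(1) P unfolding set_eq_iff by auto
    have ne: "u \<noteq> v" "u \<noteq> x" "v \<noteq> x" "u \<noteq> a" "x \<noteq> a" "u \<noteq> y" using uv nb xy edge_neq by auto
    have "conflict {v, u} {v, x}" using conflict_share[of v u x] uv nb ne by (simp add: insert_commute)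
    then have vx: "{v, x} \<in> W" using sub nb(3) by (auto simp: conflicts_def insert_commute)
    have "{u, y} \<subseteq> nbrs v \<inter> nbrs x" using uv nb xy by (auto simp: insert_commute)
    then have "card {u, y} \<le> card (nbrs v \<inter> nbrs x)" by (intro card_mono) auto
    then have "card (nbrs v \<inter> nbrs x) = 2" using cases[OF vx] ne by auto
    from two_common_neighbours[OF vx this] have "conflicts {v, x} \<subseteq> W" by metis
    moreover have "conflict {v, x} {u, a}"
      using conflict_disjoint[of v u a x] ne nb uv by (auto simp: insert_commute)
    ultimately have ua: "{u, a} \<in> W" using nb by (auto simp: conflicts_def)
    have "nbrs u \<subseteq> {v, x, y, a}" using C P by auto
    then have "nbrs u \<inter> nbrs a = {}"
      using nb xy ne no_loop by (auto simp: insert_commute)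
    then show False using cases[OF ua] by simp
  qed
  then show "card (nbrs u \<inter> nbrs v) = 1" "card (nbrs u - nbrs v - {v}) = 2" "card (nbrs v - nbrs u - {u}) = 2"
    using cases[OF W] by auto
qed

text \<open>The private neighbours of \<open>u\<close> are adjacent for lack of a claw. An edge from
  \<open>x\<close> to one of them, \<open>s\<close>, would lower the count to 13 and so put
  \<open>{u, x}\<close> into \<open>W\<close>, although \<open>u\<close> and \<open>x\<close> would
  have the two common neighbours \<open>v\<close> and \<open>s\<close>.\<close>

lemma critical_hinge:
  assumes W: "{u, v} \<in> W" and x: "{u, x} \<in> E" "{v, x} \<in> E"
  shows "\<exists>a b. hinge u v x a b"
proof -
  have uv: "{u, v} \<in> E" using W W_edges by auto
  have C: "{x} = nbrs u \<inter> nbrs v"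
  proof -
    obtain w where w: "nbrs u \<inter> nbrs v = {w}"
      using unique_common_neighbour(1)[OF W] card_1_singletonE by blast
    have "x \<in> nbrs u \<inter> nbrs v" using x by simp
    then show ?thesis using w by simp
  qed
  obtain a b where P: "{a, b} = nbrs u - nbrs v - {v}" "a \<noteq> b"
    using unique_common_neighbour(2)[OF W] by (metis card_2_iff)
  obtain c d where Q: "{c, d} = nbrs v - nbrs u - {u}" "c \<noteq> d"
    using unique_common_neighbour(3)[OF W] by (metis card_2_iff)
  have ab: "{u, a} \<in> E" "{u, b} \<in> E" "{v, a} \<notin> E" "{v, b} \<notin> E" "a \<noteq> v" "b \<noteq> v"
    using P unfolding set_eq_iff by auto
  have ne: "u \<noteq> v" "u \<noteq> x" "v \<noteq> x" "x \<noteq> a" "x \<noteq> b" using uv x ab edge_neq by auto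
  have xs: "{x, s} \<notin> E" if s: "s \<in> {a, b}" for s
  proof
    assume xs: "{x, s} \<in> E"
    have "x \<notin> {a, b}" "x \<notin> {c, d}" unfolding P(1) Q(1) using x by simp_all
    then have "card (conflicts {u, v}) + card {{x, s}} + (card {a, b} choose 2) + (card {c, d} choose 2)
        \<le> 3 * card {a, b} + 3 * card {c, d} + 4 * card {x}"
      by (intro card_conflicts_bound[OF uv C P(1) Q(1)]) (use xs s in auto)
    then have "card (conflicts {u, v}) \<le> 13" using P(2) Q(2) by (simp add: choose_two)
    then have "conflicts {u, v} \<subseteq> W" by (rule conflicts_subset_critical[OF W])
    moreover have "conflict {u, v} {u, x}" using conflict_share[of u v x] uv x ne by simp
    ultimately have ux: "{u, x} \<in> W" using x by (auto simp: conflicts_def)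
    have "{v, s} \<subseteq> nbrs u \<inter> nbrs x" using uv x ab s xs by (auto simp: insert_commute)
    then have "card {v, s} \<le> card (nbrs u \<inter> nbrs x)" by (intro card_mono) auto
    then show False using unique_common_neighbour(1)[OF ux] ab s by auto
  qed
  have "{a, b} \<in> E" using claw[of u v a b] uv ab P(2) by auto
  moreover have "nbrs u = {x} \<union> {a, b} \<union> {v}" unfolding C P(1) using uv by auto
  then have "nbrs u = {v, x, a, b}" by auto
  ultimately have "hinge u v x a b"
    using xs ab ne P(2) x by (auto simp: hinge_def)
  then show ?thesis by blast
qed

text \<open>One edge in \<open>W\<close> is the form that propagates, since a conflict may be
  missing from \<open>W\<close>. It already forces \<open>hinged\<close>, a property of the graph
  alone.\<close>

definition critical_triangle :: "'a \<Rightarrow> 'a \<Rightarrow> 'a \<Rightarrow> bool" where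
  "critical_triangle u v x \<longleftrightarrow> {u, v} \<in> E \<and> {u, x} \<in> E \<and> {v, x} \<in> E \<and>
     ({u, v} \<in> W \<or> {u, x} \<in> W \<or> {v, x} \<in> W)"

lemma critical_triangle_sym:
  "critical_triangle u v x \<longleftrightarrow> critical_triangle v u x" "critical_triangle u v x \<longleftrightarrow> critical_triangle u x v"
  by (auto simp: critical_triangle_def insert_commute)

text \<open>For the third corner, both other sides conflict with \<open>{u, v}\<close>, so one of
  them is in \<open>W\<close> and yields the hinge at \<open>x\<close>.\<close>

lemma critical_edge_hinged:
  assumes W: "{u, v} \<in> W" and x: "{u, x} \<in> E" "{v, x} \<in> E"
  shows "hinged u v x"
proof -
  have uv: "{u, v} \<in> E" "{v, u} \<in> W" using W W_edges by (auto simp: insert_commute)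
  obtain a b where u: "hinge u v x a b" using critical_hinge[OF W x] by blast
  obtain c d where v: "hinge v u x c d" using critical_hinge[OF uv(2) x(2,1)] by blast
  have ne: "u \<noteq> v" "u \<noteq> x" "v \<noteq> x" using uv(1) x edge_neq by auto
  have "{u, x} \<in> W \<or> {v, x} \<in> W"
  proof (rule one_of_two_conflicts[OF W card_conflicts_hinge_14[OF u v]])
    show "{u, x} \<in> conflicts {u, v}"
      using conflict_share[of u v x] uv x ne by (auto simp: conflicts_def)
    show "{v, x} \<in> conflicts {u, v}"
      using conflict_share[of v u x] uv x ne by (auto simp: conflicts_def insert_commute)
    show "{u, x} \<noteq> {v, x}" using ne by (auto simp: doubleton_eq_iff)
  qed
  then have "\<exists>y z. hinge x u v y z"
  proof
    assume "{u, x} \<in> W"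
    then show ?thesis using critical_hinge[of x u v] uv x by (simp add: insert_commute)
  next
    assume "{v, x} \<in> W"
    then show ?thesis using critical_hinge[of x v u] uv x hinge_swap_left by (metis insert_commute)
  qed
  then show ?thesis using u v unfolding hinged_def by blast
qed

lemma critical_triangle_hinged:
  assumes "critical_triangle u v x"
  shows "hinged u v x"
proof -
  consider "{u, v} \<in> W" | "{u, x} \<in> W" | "{v, x} \<in> W" using assms by (auto simp: critical_triangle_def)
  then show ?thesis
  proof cases
    case 1
    then show ?thesis using critical_edge_hinged assms by (auto simp: critical_triangle_def)
  next
    case 2
    then have "hinged u x v"
      using critical_edge_hinged[of u x v] assms by (auto simp: critical_triangle_def insert_commute)
    then show ?thesis using hinged_sym by blast
  next
    case 3
    then have "hinged v x u"
      using critical_edge_hinged[of v x u] assms by (auto simp: critical_triangle_def insert_commute)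
    then show ?thesis using hinged_sym by blast
  qed
qed

text \<open>A side at \<open>u\<close> in \<open>W\<close> conflicts with \<open>{a, b}\<close> and
  \<open>{v, x}\<close>, so one of these is in \<open>W\<close>; and \<open>{v, x}\<close> conflicts
  with both \<open>{u, a}\<close> and \<open>{u, b}\<close>.\<close>

lemma critical_triangle_adjacent:
  assumes T: "critical_triangle u v x" and h: "hinge u v x a b"
  shows "critical_triangle u a b"
proof -
  have hinged: "hinged u v x" "hinged u x v" "hinged v x u"
    using critical_triangle_hinged[OF T] hinged_sym by blast+
  note e = hinge_edges[OF h]
  have ne: "distinct [u, v, x, a, b]" using h e edge_neq by (auto simp: hinge_def)
  have *: "{a, b} \<in> W \<or> {q, r} \<in> W" if W: "{u, q} \<in> W" and qr: "{q, r} = {v, x}" "hinged u q r" for q r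
  proof (rule one_of_two_conflicts[OF W card_conflicts_hinged[OF qr(2)]])
    have q: "q \<in> {v, x}" "r \<in> {v, x}" "{u, q} \<in> E" "{q, r} \<in> E" "{u, r} \<in> E" "q \<noteq> r"
      using qr e ne by (auto simp: doubleton_eq_iff insert_commute)
    show "{a, b} \<in> conflicts {u, q}"
      using conflict_disjoint[of u a b q] e ne q by (auto simp: conflicts_def)
    show "{q, r} \<in> conflicts {u, q}"
      using conflict_share[of q u r] e ne q by (auto simp: conflicts_def insert_commute)
    show "{a, b} \<noteq> {q, r}" using ne q by (auto simp: doubleton_eq_iff)
  qed
  have **: "{u, a} \<in> W \<or> {u, b} \<in> W" if W: "{v, x} \<in> W"
  proof (rule one_of_two_conflicts[OF W card_conflicts_hinged[OF hinged(3)]])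
    show "{u, a} \<in> conflicts {v, x}" "{u, b} \<in> conflicts {v, x}"
      using conflict_disjoint[of v u a x] conflict_disjoint[of v u b x] e ne
      by (auto simp: conflicts_def insert_commute)
    show "{u, a} \<noteq> {u, b}" using ne by (auto simp: doubleton_eq_iff)
  qed
  have "{u, v} \<in> W \<or> {u, x} \<in> W \<or> {v, x} \<in> W" using T by (auto simp: critical_triangle_def)
  then have "{u, a} \<in> W \<or> {u, b} \<in> W \<or> {a, b} \<in> W"
    using *[of v x] *[of x v] ** hinged by (auto simp: insert_commute)
  then show ?thesis using e by (auto simp: critical_triangle_def)
qed

text \<open>The edges \<open>e i\<close> need not all lie in \<open>W\<close>; one that does makes
  \<open>W - S\<close> a proper subset. An edge with at most 14 - s conflicts, d of them in
  \<open>S\<close>, loses at most 14 - s - d of the 13 colours to the outside and keeps at least d +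
  s - 1.\<close>

lemma not_slack_colorable:
  fixes e :: "nat \<Rightarrow> 'a set"
  assumes inj: "inj_on e {..<n}" and E: "\<And>i. i < n \<Longrightarrow> e i \<in> E" and W: "\<exists>i<n. e i \<in> W"
    and slack: "\<And>i. i < n \<Longrightarrow> card (conflicts (e i)) + s i \<le> 14"
  shows "\<not> slack_colorable (\<lambda>i j. conflict (e i) (e j)) {..<n} s"
proof
  assume ok: "slack_colorable (\<lambda>i j. conflict (e i) (e j)) {..<n} s"
  define S where "S = e ` {..<n}"
  have "W - S \<subset> W" using W unfolding S_def by blast
  from proper_colorable[OF this] obtain \<phi> where \<phi>: "\<forall>f\<in>W - S. \<phi> f \<in> {1..13::nat}"
      "\<forall>f\<in>W - S. \<forall>g\<in>W - S. conflict f g \<longrightarrow> \<phi> f \<noteq> \<phi> g"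
    unfolding list_colorable_def by blast
  define L where "L i = {1..13} - \<phi> ` (conflicts (e i) \<inter> (W - S))" for i
  have "list_colorable (\<lambda>i j. conflict (e i) (e j)) {..<n} L"
  proof (rule ok[unfolded slack_colorable_def, rule_format])
    fix i assume i: "i \<in> {..<n}"
    have "card (\<phi> ` (conflicts (e i) \<inter> (W - S))) \<le> card (conflicts (e i) \<inter> (W - S))"
      by (rule card_image_le) simp
    also have "\<dots> \<le> card (conflicts (e i) - S)" by (intro card_mono) auto
    finally have "13 \<le> card (L i) + card (conflicts (e i) - S)"
      using diff_card_le_card_Diff[of "\<phi> ` (conflicts (e i) \<inter> (W - S))" "{1..13}"]
      by (simp add: L_def)
    moreover have "degree_in (\<lambda>i j. conflict (e i) (e j)) {..<n} i = card (conflicts (e i) \<inter> S)"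
    proof -
      have "conflicts (e i) \<inter> S = e ` {j \<in> {..<n}. conflict (e i) (e j)}"
        using E by (auto simp: S_def conflicts_def)
      moreover have "inj_on e {j \<in> {..<n}. conflict (e i) (e j)}"
        using inj by (rule inj_on_subset) auto
      ultimately show ?thesis by (simp add: degree_in_def card_image)
    qed
    moreover have "card (conflicts (e i)) = card (conflicts (e i) \<inter> S) + card (conflicts (e i) - S)"
      by (metis finite_conflicts card_Int_Diff)
    ultimately show "finite (L i) \<and>
        degree_in (\<lambda>i j. conflict (e i) (e j)) {..<n} i + s i \<le> card (L i) + 1"
      using slack[of i] i by (simp add: L_def)
  qed
  then obtain \<psi> where \<psi>: "\<forall>i<n. \<psi> i \<in> L i" "\<forall>i<n. \<forall>j<n. conflict (e i) (e j) \<longrightarrow> \<psi> i \<noteq> \<psi> j"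
    unfolding list_colorable_def by blast
  define \<chi> where "\<chi> f = (if f \<in> S then \<psi> (inv_into {..<n} e f) else \<phi> f)" for f
  have \<chi>_e: "\<chi> (e i) = \<psi> i" if "i < n" for i
    using that inj by (simp add: \<chi>_def S_def)
  have mixed: "\<chi> f \<noteq> \<chi> g" if "f \<in> S" "g \<in> W - S" "conflict f g" for f g
  proof -
    obtain i where i: "f = e i" "i < n" using \<open>f \<in> S\<close> by (auto simp: S_def)
    have "g \<in> conflicts (e i)" using that i W_edges by (auto simp: conflicts_def)
    then have "\<psi> i \<noteq> \<phi> g" using \<psi>(1) i(2) that(2) by (auto simp: L_def)
    then show ?thesis using \<chi>_e[OF i(2)] that(2) i(1) by (simp add: \<chi>_def)
  qed
  have "list_colorable conflict W (\<lambda>_. {1..13::nat})"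
    unfolding list_colorable_def
  proof (intro exI[of _ \<chi>] conjI ballI impI)
    fix f assume f: "f \<in> W"
    show "\<chi> f \<in> {1..13}"
    proof (cases "f \<in> S")
      case True
      then obtain i where "f = e i" "i < n" by (auto simp: S_def)
      then show ?thesis using \<chi>_e \<psi>(1) by (auto simp: L_def)
    next
      case False
      then show ?thesis using \<phi>(1) f by (simp add: \<chi>_def)
    qed
    fix g assume g: "g \<in> W" and fg: "conflict f g"
    consider "f \<in> S" "g \<in> S" | "f \<in> S" "g \<notin> S" | "f \<notin> S" "g \<in> S" | "f \<notin> S" "g \<notin> S" by blast
    then show "\<chi> f \<noteq> \<chi> g"
    proof cases
      case 1
      then obtain i j where "f = e i" "i < n" "g = e j" "j < n" by (auto simp: S_def)
      then show ?thesis using \<chi>_e \<psi>(2) fg by simp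
    next
      case 2
      then show ?thesis using mixed fg g by simp
    next
      case 3
      then show ?thesis using mixed[of g f] fg f conflict_sym by auto
    next
      case 4
      then show ?thesis using \<phi>(2) f g fg by (simp add: \<chi>_def)
    qed
  qed
  then show False using not_colorable by contradiction
qed

end

section \<open>Recolouring around a critical triangle\<close>

context critical
begin

definition config :: "'a \<Rightarrow> 'a \<Rightarrow> 'a \<Rightarrow> 'a \<Rightarrow> 'a \<Rightarrow> 'a \<Rightarrow> 'a \<Rightarrow> 'a \<Rightarrow> 'a \<Rightarrow> bool" where
  "config u v x a b c d y z \<longleftrightarrow>
     critical_triangle u v x \<and> hinge u v x a b \<and> hinge v u x c d \<and> hinge x u v y z \<and>
     hinged u a b \<and> hinged v c d \<and> hinged x y z"

definition config_edges :: "'a \<Rightarrow> 'a \<Rightarrow> 'a \<Rightarrow> 'a \<Rightarrow> 'a \<Rightarrow> 'a \<Rightarrow> 'a \<Rightarrow> 'a \<Rightarrow> 'a \<Rightarrow> 'a set list" where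
  "config_edges u v x a b c d y z =
     [{v, x}, {u, x}, {u, v}, {a, b}, {c, d}, {y, z}, {u, a}, {u, b}, {v, c}, {v, d}, {x, y}, {x, z}]"

lemma critical_triangle_config:
  assumes T: "critical_triangle u v x"
  obtains a b c d y z where "config u v x a b c d y z"
proof -
  obtain a b c d y z where h: "hinge u v x a b" "hinge v u x c d" "hinge x u v y z"
    using critical_triangle_hinged[OF T] unfolding hinged_def by blast
  have "critical_triangle v u x" "critical_triangle x u v"
    using T critical_triangle_sym by blast+
  then have "hinged u a b" "hinged v c d" "hinged x y z"
    using critical_triangle_adjacent critical_triangle_hinged T h by blast+
  then show thesis using that T h unfolding config_def by blast
qed

lemma config_swap:
  assumes "config u v x a b c d y z"
  shows "config u v x b a c d y z" "config v u x c d a b y z" "config u x v a b y z c d"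
  using assms hinged_sym critical_triangle_sym
  unfolding config_def by (meson hinge_swap)+

text \<open>Each outer vertex is adjacent to exactly one corner of the inner triangle, so the outer
  pairs are disjoint.\<close>

lemma config_distinct:
  assumes "config u v x a b c d y z"
  shows "distinct [u, v, x, a, b, c, d, y, z]"
proof -
  have h: "hinge u v x a b" "hinge v u x c d" "hinge x u v y z" using assms by (auto simp: config_def)
  have "distinct [u, v, x]" "distinct [u, a, b]" "distinct [v, c, d]" "distinct [x, y, z]"
    using hinge_edges[OF h(1)] hinge_edges[OF h(2)] hinge_edges[OF h(3)] edge_neq by auto
  moreover have "w \<notin> nbrs v" "w \<notin> nbrs x" "w \<in> nbrs u" "w \<noteq> v" "w \<noteq> x" if "w \<in> {a, b}" for w
    using that h(1) by (auto simp: hinge_def hinge_nbr[OF h(1)])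
  moreover have "w \<notin> nbrs u" "w \<notin> nbrs x" "w \<in> nbrs v" "w \<noteq> u" "w \<noteq> x" if "w \<in> {c, d}" for w
    using that h(2) by (auto simp: hinge_def hinge_nbr[OF h(2)])
  moreover have "w \<notin> nbrs u" "w \<notin> nbrs v" "w \<in> nbrs x" "w \<noteq> u" "w \<noteq> v" if "w \<in> {y, z}" for w
    using that h(3) by (auto simp: hinge_def hinge_nbr[OF h(3)])
  ultimately show ?thesis by (simp del: nbrs_iff) metis
qed

text \<open>This supplies the disequalities in the opposite orientation, for the side conditions met
  in simplification.\<close>

lemma config_distinct_rev: "config u v x a b c d y z \<Longrightarrow> distinct [z, y, d, c, b, a, x, v, u]"
  using distinct_rev[of "[u, v, x, a, b, c, d, y, z]"] config_distinct by simp

lemma config_adjacency: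
  assumes "config u v x a b c d y z"
  shows "\<forall>p\<in>{a, b}. {v, p} \<notin> E \<and> {p, v} \<notin> E \<and> {x, p} \<notin> E \<and> {p, x} \<notin> E \<and> {u, p} \<in> E \<and> {p, u} \<in> E"
    "\<forall>p\<in>{c, d}. {u, p} \<notin> E \<and> {p, u} \<notin> E \<and> {x, p} \<notin> E \<and> {p, x} \<notin> E \<and> {v, p} \<in> E \<and> {p, v} \<in> E"
    "\<forall>p\<in>{y, z}. {u, p} \<notin> E \<and> {p, u} \<notin> E \<and> {v, p} \<notin> E \<and> {p, v} \<notin> E \<and> {x, p} \<in> E \<and> {p, x} \<in> E"
    "{u, v} \<in> E" "{v, u} \<in> E" "{u, x} \<in> E" "{x, u} \<in> E" "{v, x} \<in> E" "{x, v} \<in> E"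
    "{a, b} \<in> E" "{b, a} \<in> E" "{c, d} \<in> E" "{d, c} \<in> E" "{y, z} \<in> E" "{z, y} \<in> E"
proof -
  have h: "hinge u v x a b" "hinge v u x c d" "hinge x u v y z" using assms by (auto simp: config_def)
  note e = hinge_edges[OF h(1)] hinge_edges[OF h(2)] hinge_edges[OF h(3)]
  show "\<forall>p\<in>{a, b}. {v, p} \<notin> E \<and> {p, v} \<notin> E \<and> {x, p} \<notin> E \<and> {p, x} \<notin> E \<and> {u, p} \<in> E \<and> {p, u} \<in> E"
    "\<forall>p\<in>{c, d}. {u, p} \<notin> E \<and> {p, u} \<notin> E \<and> {x, p} \<notin> E \<and> {p, x} \<notin> E \<and> {v, p} \<in> E \<and> {p, v} \<in> E"
    "\<forall>p\<in>{y, z}. {u, p} \<notin> E \<and> {p, u} \<notin> E \<and> {v, p} \<notin> E \<and> {p, v} \<notin> E \<and> {x, p} \<in> E \<and> {p, x} \<in> E"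
    using e h by (simp_all add: hinge_def insert_commute)
  show "{u, v} \<in> E" "{v, u} \<in> E" "{u, x} \<in> E" "{x, u} \<in> E" "{v, x} \<in> E" "{x, v} \<in> E"
    "{a, b} \<in> E" "{b, a} \<in> E" "{c, d} \<in> E" "{d, c} \<in> E" "{y, z} \<in> E" "{z, y} \<in> E"
    using e by (simp_all add: insert_commute)
qed

lemma config_near:
  assumes c: "config u v x a b c d y z"
  shows "\<forall>(i, j)\<in>set near_pairs. conflict (config_edges u v x a b c d y z ! i) (config_edges u v x a b c d y z ! j)"
  using config_distinct[OF c] config_distinct_rev[OF c] config_adjacency[OF c]
  by (simp add: near_pairs_def config_edges_def conflict_disjoint conflict_share conflict_share')

lemma config_far:
  assumes c: "config u v x a b c d y z"
  shows "\<forall>(i, j)\<in>set far_pairs. \<not> conflict (config_edges u v x a b c d y z ! i) (config_edges u v x a b c d y z ! j)"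
  using config_distinct[OF c] config_distinct_rev[OF c] config_adjacency[OF c]
  by (simp add: far_pairs_def config_edges_def conflict_disjoint conflict_share conflict_share')

lemma config_conflicts:
  assumes c: "config u v x a b c d y z" and i: "i < 12"
  shows "card (conflicts (config_edges u v x a b c d y z ! i)) \<le> 14"
proof -
  have h: "hinged u v x" "hinged u a b" "hinged v c d" "hinged x y z"
    using c critical_triangle_hinged by (auto simp: config_def)
  have T: "card (conflicts {p, q}) \<le> 14 \<and> card (conflicts {p, r}) \<le> 14 \<and> card (conflicts {q, r}) \<le> 14"
    if "hinged p q r" for p q r
    using that card_conflicts_hinged hinged_sym by metis
  have "\<forall>e\<in>set (config_edges u v x a b c d y z). card (conflicts e) \<le> 14"
    using h[THEN T] by (simp add: config_edges_def)
  moreover have "length (config_edges u v x a b c d y z) = 12" by (simp add: config_edges_def)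
  ultimately show ?thesis using i by (metis nth_mem)
qed

lemma config_not_slack_colorable:
  assumes c: "config u v x a b c d y z" and es: "es = config_edges u v x a b c d y z"
    and s: "\<And>i. i < 12 \<Longrightarrow> card (conflicts (es ! i)) + s i \<le> 14"
  shows "\<not> slack_colorable (\<lambda>i j. conflict (es ! i) (es ! j)) {..<12} s"
proof (rule not_slack_colorable[OF _ _ _ s])
  have len: "length es = 12" by (simp add: es config_edges_def)
  have "distinct es"
    using config_distinct[OF c] config_distinct_rev[OF c] by (simp add: es config_edges_def doubleton_eq_iff)
  then show "inj_on ((!) es) {..<12}" by (simp add: inj_on_nth len)
  show "es ! i \<in> E" if "i < 12" for i
  proof -
    have "es ! i \<in> set es" using that len by simp
    then show ?thesis using config_adjacency[OF c] by (auto simp: es config_edges_def)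
  qed
  have "\<exists>e\<in>set es. e \<in> W"
    using c by (auto simp: es config_edges_def config_def critical_triangle_def)
  then show "\<exists>i<12. es ! i \<in> W" by (metis in_set_conv_nth len)
qed

text \<open>Without such an edge no pair in \<open>cross_far_pairs\<close> is a conflict, and
  \<open>separated_strategy\<close> succeeds with slack 0 everywhere.\<close>

lemma config_separated:
  assumes c: "config u v x a b c d y z"
  shows "\<exists>p\<in>{a, b}. \<exists>q\<in>{c, d}. \<exists>r\<in>{y, z}. {p, q} \<in> E \<or> {p, r} \<in> E \<or> {q, r} \<in> E"
proof (rule ccontr)
  assume "\<not> ?thesis"
  then have n: "\<forall>p\<in>{a, b}. \<forall>q\<in>{c, d}. \<forall>r\<in>{y, z}. {p, q} \<notin> E \<and> {q, p} \<notin> E \<and> {p, r} \<notin> E \<and> {r, p} \<notin> E \<and>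
      {q, r} \<notin> E \<and> {r, q} \<notin> E"
    by (simp add: insert_commute)
  define es where "es = config_edges u v x a b c d y z"
  have cross: "\<forall>(i, j)\<in>set cross_far_pairs. \<not> conflict (es ! i) (es ! j)"
    using config_distinct[OF c] config_distinct_rev[OF c] config_adjacency[OF c] n
    by (simp add: cross_far_pairs_def es_def config_edges_def conflict_disjoint)
  have "slack_colorable (\<lambda>i j. conflict (es ! i) (es ! j)) {..<12} (\<lambda>i. replicate 12 0 ! i)"
    by (rule slack_colorable_strategy[OF _ _ _ _ valid_separated_strategy])
      (use conflict_sym config_near[OF c] config_far[OF c] cross in
        \<open>auto simp: es_def[symmetric] symp_def irreflp_def conflict_def\<close>)
  moreover have "card (conflicts (es ! i)) + replicate 12 0 ! i \<le> 14" if "i < 12" for i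
    using config_conflicts[OF c that] that by (simp add: es_def)
  ultimately show False using config_not_slack_colorable[OF c es_def] by blast
qed

text \<open>The edge closes a 4-cycle u, a, c, v. It joins private neighbours of the two ends of
  \<open>{u, v}\<close>; so do \<open>{v, c}\<close> for \<open>{u, a}\<close> and
  \<open>{u, a}\<close> for \<open>{v, c}\<close>. Hence these three edges have at most 13 conflicts
  and gain slack 1.\<close>

lemma config_square:
  assumes c: "config u v x a b c d y z"
  shows "{a, c} \<notin> E"
proof
  assume ac: "{a, c} \<in> E"
  define es where "es = config_edges u v x a b c d y z"
  have ca: "{c, a} \<in> E" using ac by (simp add: insert_commute)
  note dist = config_distinct[OF c] config_distinct_rev[OF c] and adj = config_adjacency[OF c]
  have near: "\<forall>(i, j)\<in>set (near_pairs @ [(3,4), (3,8), (4,6)]). conflict (es ! i) (es ! j)"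
    using config_near[OF c] dist ac ca by (simp add: es_def config_edges_def conflict_disjoint)
  have "slack_colorable (\<lambda>i j. conflict (es ! i) (es ! j)) {..<12} (\<lambda>i. [0,0,1,0,0,0,1,0,1,0,0,0] ! i)"
    by (rule slack_colorable_strategy[OF _ _ near _ valid_square_strategy])
      (use conflict_sym config_far[OF c] in
        \<open>auto simp: es_def[symmetric] symp_def irreflp_def conflict_def\<close>)
  moreover have "card (conflicts (es ! i)) + [0,0,1,0,0,0,1,0,1,0,0,0] ! i \<le> 14" if i: "i < 12" for i
  proof -
    have h: "hinge u v x a b" "hinge v u x c d" "hinged u a b" "hinged v c d"
      using c by (auto simp: config_def)
    obtain a' a'' where a: "hinge a u b a' a''" using h(3) by (auto simp: hinged_def)
    obtain c' c'' where c: "hinge c v d c' c''" using h(4) by (auto simp: hinged_def)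
    have "c \<in> {a', a''}" using hinge_nbr[OF a, of c] ac dist by auto
    then have "card (conflicts {u, a}) \<le> 13"
      using card_conflicts_hinge_13[OF hinge_swap_sides[OF h(1)] a, of v c] adj by simp
    moreover have "a \<in> {c', c''}" using hinge_nbr[OF c, of a] ca dist by auto
    then have "card (conflicts {v, c}) \<le> 13"
      using card_conflicts_hinge_13[OF hinge_swap_sides[OF h(2)] c, of u a] adj by simp
    moreover have "card (conflicts {u, v}) \<le> 13"
      using card_conflicts_hinge_13[OF h(1,2) ac] by simp
    moreover have "card (conflicts (es ! i)) \<le> 14"
      using config_conflicts[OF assms i] by (simp add: es_def)
    moreover have "i \<in> {0, 1, 2, 3, 4, 5, 6, 7, 8, 9, 10, 11}" using i by simp presburger
    ultimately show ?thesis unfolding es_def config_edges_def by auto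
  qed
  ultimately show False using config_not_slack_colorable[OF c es_def] by blast
qed

text \<open>The symmetries in \<open>config_swap\<close> carry \<open>config_square\<close> to all
  twelve possible edges between outer pairs, which contradicts
  \<open>config_separated\<close>.\<close>

lemma no_critical_triangle: "\<not> critical_triangle u v x"
proof
  assume "critical_triangle u v x"
  then obtain a b c d y z where conf: "config u v x a b c d y z"
    by (rule critical_triangle_config)
  have no: "{p, q} \<notin> E"
    if "config u' v' x' a' b' c' d' y' z'" "p \<in> {a', b'}" "q \<in> {c', d'}" for u' v' x' a' b' c' d' y' z' p q
  proof -
    have ba: "config u' v' x' b' a' c' d' y' z'" by (rule config_swap(1)[OF that(1)])
    have "config u' v' x' a' b' d' c' y' z'" "config u' v' x' b' a' d' c' y' z'"
      using config_swap(2)[OF config_swap(1)[OF config_swap(2)[OF that(1)]]]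
        config_swap(2)[OF config_swap(1)[OF config_swap(2)[OF ba]]] by blast+
    with ba show ?thesis using config_square that by blast
  qed
  have "config u x v a b y z c d" "config v x u c d y z a b"
    using config_swap(3)[OF conf] config_swap(3)[OF config_swap(2)[OF conf]] by blast+
  then show False using config_separated[OF conf] no conf by blast
qed

lemma critical_False: False
proof -
  have "W \<noteq> {}" using not_colorable by (auto simp: list_colorable_def)
  then obtain u v where W: "{u, v} \<in> W" using W_edges edge_cases by (metis all_not_in_conv subsetD)
  have "nbrs u \<inter> nbrs v \<noteq> {}" using unique_common_neighbour(1)[OF W] by auto
  then obtain x where "{u, x} \<in> E" "{v, x} \<in> E" by auto
  then have "critical_triangle u v x" using W W_edges by (auto simp: critical_triangle_def)
  then show False using no_critical_triangle by blast
qed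

end

section \<open>From minimal sets of edges back to the given graph\<close>

lemma (in claw_free_degree_4) list_colorable_edges: "list_colorable conflict E (\<lambda>_. {1..13::nat})"
proof (rule ccontr)
  assume "\<not> ?thesis"
  then obtain W where W: "W \<subseteq> E \<and> \<not> list_colorable conflict W (\<lambda>_. {1..13::nat})"
    and least: "\<And>F. F \<subseteq> E \<and> \<not> list_colorable conflict F (\<lambda>_. {1..13::nat}) \<Longrightarrow> card W \<le> card F"
    using ex_has_least_nat[of "\<lambda>F. F \<subseteq> E \<and> \<not> list_colorable conflict F (\<lambda>_. {1..13::nat})" E card]
    by auto
  interpret critical V E W
  proof
    show "list_colorable conflict F (\<lambda>_. {1..13::nat})" if "F \<subset> W" for F
      using least[of F] psubset_card_mono[of W F] that W finite_subset[of W E] by fastforce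
  qed (use W in auto)
  show False by (rule critical_False)
qed

lemma claw_freeD:
  assumes "finite_simple_graph V E" "claw_free V E"
    and "{v, a} \<in> E" "{v, b} \<in> E" "{v, c} \<in> E" "a \<noteq> b" "a \<noteq> c" "b \<noteq> c"
  shows "{a, b} \<in> E \<or> {a, c} \<in> E \<or> {b, c} \<in> E"
proof (rule ccontr)
  assume n: "\<not> ?thesis"
  interpret finite_simple_graph V E by fact
  \<comment> \<open>The isomorphism condition also ranges over equal vertices, where the pair
    collapses to a singleton.\<close>
  have loop: "{w} \<notin> E" for w using edge_card[of "{w}"] by auto
  have ne: "v \<noteq> a" "v \<noteq> b" "v \<noteq> c" using assms(3-5) loop by auto
  define S where "S = {v, a, b, c}"
  define f :: "'a \<Rightarrow> nat" where "f w = (if w = v then 0 else if w = a then 1 else if w = b then 2 else 3)" for w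
  have f: "f v = 0" "f a = 1" "f b = 2" "f c = 3" using ne assms(6-8) by (auto simp: f_def)
  have "S \<subseteq> V" using edge_subset assms(3-5) by (force simp: S_def)
  moreover have "bij_betw f S claw_vertices"
    unfolding bij_betw_def S_def claw_vertices_def using f by auto
  moreover have "{p, q} \<in> induced_edges E S \<longleftrightarrow> {f p, f q} \<in> claw_edges" if "p \<in> S" "q \<in> S" for p q
    using that assms(3-5) n loop f unfolding S_def induced_edges_def claw_edges_def
    by (auto simp: insert_commute doubleton_eq_iff)
  ultimately show False
    using assms(2) unfolding claw_free_def graph_isomorphic_def by blast
qed

lemma degree_le_max_degree:
  assumes "finite_simple_graph V E"
  shows "degree E v \<le> max_degree V E"
proof (cases "v \<in> V")
  case True
  then show ?thesis
    using finite_simple_graph.finite_vertices[OF assms] by (simp add: max_degree_def)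
next
  case False
  then have "{e \<in> E. v \<in> e} = {}" using finite_simple_graph.edge_subset[OF assms] by blast
  then show ?thesis unfolding degree_def by (metis card.empty zero_le)
qed

theorem theorem1p2:
  fixes V :: "'a set" and E :: "'a set set"
  assumes "finite_simple_graph V E"
    and "claw_free V E"
    and "max_degree V E \<le> 4"
  shows "injective_chromatic_index E \<le> 13 \<and> (\<exists>\<phi>. injective_edge_coloring E 13 \<phi>)"
proof -
  interpret finite_simple_graph V E by fact
  interpret claw_free_degree_4 V E
    by unfold_locales
      (fact claw_freeD[OF assms(1,2)], fact order_trans[OF degree_le_max_degree[OF assms(1)] assms(3)])
  obtain \<phi> where "\<forall>e\<in>E. \<phi> e \<in> {1..13::nat}" "\<forall>e\<in>E. \<forall>f\<in>E. conflict e f \<longrightarrow> \<phi> e \<noteq> \<phi> f"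
    using list_colorable_edges unfolding list_colorable_def by blast
  then have "injective_edge_coloring E 13 \<phi>"
    unfolding injective_edge_coloring_def conflict_def by blast
  then show ?thesis
    unfolding injective_chromatic_index_def by (blast intro: Least_le)
qed

end
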